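(* Let $d \geq 3$ be an integer and let $T_d$ be the $d$-regular infinite tree. For any real number $\lambda$ with $|\lambda| \leq 2\sqrt{d-1}$ there exists a sequence of linear factor of i.i.d. processes on $T_d$ that converges in distribution to the Gaussian wave function on $T_d$ with eigenvalue $\lambda$.
   Context: Let $Z_v$, $v \in V(T_d)$, be independent standard normal random variables, and let $d(v,u)$ denote the graph distance in $T_d$. A process $X_v$, $v\in V(T_d)$, is a linear factor of the i.i.d. process $Z_v$ (a linear factor of i.i.d. process) if there are real numbers $\alpha_0,\alpha_1,\ldots$ such that $$X_v = \sum_{k=0}^\infty \sum_{u:\, d(v,u)=k} \alpha_k Z_u \quad \text{for all } v,$$ where $\alpha_0^2 + \sum_{k=1}^\infty d(d-1)^{k-1}\alpha_k^2 < \infty$ (equivalently, the sum converges almost surely). A Gaussian process on $T_d$ is a collection of jointly Gaussian centered random variables $X_v$, $v \in V(T_d)$; it is invariant if its joint distribution is unchanged under every graph automorphism of $T_d$. For $|\lambda|\le d$, the Gaussian wave function with eigenvalue $\lambda$ is the invariant Gaussian process $(X_v)_{v\in V(T_d)}$, which exists and is unique in distribution, such that $\mathrm{var}(X_v)=1$ for all $v$ and, with probability $1$, $\sum_{u\in N(v)} X_u = \lambda X_v$ for every vertex $v$, where $N(v)$ is the set of neighbors of $v$. Convergence in distribution of processes indexed by the countable set $V(T_d)$ means convergence in distribution of all finite-dimensional marginals. *)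

theory Defs
  imports "HOL-Probability.Probability"
begin

text \<open>Graphs are given by an adjacency relation whose vertex set is the whole type
  \<^typ>\<open>'v\<close>.\<close>

definition graph_cycle :: "('v \<Rightarrow> 'v \<Rightarrow> bool) \<Rightarrow> 'v list \<Rightarrow> bool" where
  "graph_cycle adj xs \<longleftrightarrow>
     3 \<le> length xs \<and> distinct xs \<and> successively adj xs \<and> adj (last xs) (hd xs)"

definition regular_tree :: "nat \<Rightarrow> ('v \<Rightarrow> 'v \<Rightarrow> bool) \<Rightarrow> bool" where
  "regular_tree d adj \<longleftrightarrow>
     symp adj \<and> irreflp adj \<and>
     (\<forall>u v. adj\<^sup>*\<^sup>* u v) \<and>
     (\<nexists>xs. graph_cycle adj xs) \<and>
     (\<forall>v. finite {u. adj v u} \<and> card {u. adj v u} = d)"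

text \<open>The value is meaningful for vertices in the same connected component; in a
  tree this is every pair.\<close>

definition graph_dist :: "('v \<Rightarrow> 'v \<Rightarrow> bool) \<Rightarrow> 'v \<Rightarrow> 'v \<Rightarrow> nat" where
  "graph_dist adj u v = (LEAST n. (adj ^^ n) u v)"

definition graph_automorphism :: "('v \<Rightarrow> 'v \<Rightarrow> bool) \<Rightarrow> ('v \<Rightarrow> 'v) \<Rightarrow> bool" where
  "graph_automorphism adj \<phi> \<longleftrightarrow> bij \<phi> \<and> (\<forall>u v. adj (\<phi> u) (\<phi> v) \<longleftrightarrow> adj u v)"

definition iid_std_normal :: "'a measure \<Rightarrow> ('v \<Rightarrow> 'a \<Rightarrow> real) \<Rightarrow> bool" where
  "iid_std_normal M Z \<longleftrightarrow>
     prob_space.indep_vars M (\<lambda>_. borel) Z UNIV \<and>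
     (\<forall>v. distributed M lborel (Z v) std_normal_density)"

text \<open>The defining identity is almost sure, as the series converges only almost surely.\<close>

definition linear_factor_of_iid ::
    "nat \<Rightarrow> ('v \<Rightarrow> 'v \<Rightarrow> bool) \<Rightarrow> 'a measure \<Rightarrow> ('v \<Rightarrow> 'a \<Rightarrow> real) \<Rightarrow> ('v \<Rightarrow> 'a \<Rightarrow> real) \<Rightarrow> bool" where
  "linear_factor_of_iid d adj M Z X \<longleftrightarrow>
     (\<forall>v. X v \<in> borel_measurable M) \<and>
     (\<exists>\<alpha> :: nat \<Rightarrow> real.
        summable (\<lambda>k. real d * (real d - 1) ^ k * (\<alpha> (Suc k))\<^sup>2) \<and>
        (\<forall>v. AE \<omega> in M. (\<lambda>k. \<Sum>u | graph_dist adj v u = k. \<alpha> k * Z u \<omega>) sums X v \<omega>))"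

text \<open>Joint Gaussianity: every finite linear combination is normal, where the point mass
  at \<open>0\<close> counts as the normal distribution of variance \<open>0\<close>.\<close>

definition centered_normal :: "'a measure \<Rightarrow> ('a \<Rightarrow> real) \<Rightarrow> bool" where
  "centered_normal M Y \<longleftrightarrow>
     Y \<in> borel_measurable M \<and>
     ((AE \<omega> in M. Y \<omega> = 0) \<or> (\<exists>\<sigma>>0. distributed M lborel Y (normal_density 0 \<sigma>)))"

definition gaussian_process :: "'a measure \<Rightarrow> ('v \<Rightarrow> 'a \<Rightarrow> real) \<Rightarrow> bool" where
  "gaussian_process M X \<longleftrightarrow>
     prob_space M \<and>
     (\<forall>S (c :: 'v \<Rightarrow> real). finite S \<longrightarrow> centered_normal M (\<lambda>\<omega>. \<Sum>v\<in>S. c v * X v \<omega>))"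

definition invariant_process ::
    "('v \<Rightarrow> 'v \<Rightarrow> bool) \<Rightarrow> 'a measure \<Rightarrow> ('v \<Rightarrow> 'a \<Rightarrow> real) \<Rightarrow> bool" where
  "invariant_process adj M X \<longleftrightarrow>
     (\<forall>\<phi>. graph_automorphism adj \<phi> \<longrightarrow>
        distr M (\<Pi>\<^sub>M v\<in>UNIV. borel) (\<lambda>\<omega> v. X (\<phi> v) \<omega>) =
        distr M (\<Pi>\<^sub>M v\<in>UNIV. borel) (\<lambda>\<omega> v. X v \<omega>))"

definition gaussian_wave_function ::
    "('v \<Rightarrow> 'v \<Rightarrow> bool) \<Rightarrow> real \<Rightarrow> 'a measure \<Rightarrow> ('v \<Rightarrow> 'a \<Rightarrow> real) \<Rightarrow> bool" where
  "gaussian_wave_function adj \<theta> M X \<longleftrightarrow>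
     gaussian_process M X \<and> invariant_process adj M X \<and>
     (\<forall>v. prob_space.variance M (X v) = 1) \<and>
     (AE \<omega> in M. \<forall>v. (\<Sum>u | adj v u. X u \<omega>) = \<theta> * X v \<omega>)"

text \<open>Convergence of the finite-dimensional marginals: for every finite \<open>S\<close>, weak
  convergence on the product space of functions on \<open>S\<close>, tested on bounded continuous
  functions. The library's \<open>weak_conv_m\<close> covers only measures on the real line.\<close>

definition fdd_converges ::
    "'a measure \<Rightarrow> (nat \<Rightarrow> 'v \<Rightarrow> 'a \<Rightarrow> real) \<Rightarrow> 'b measure \<Rightarrow> ('v \<Rightarrow> 'b \<Rightarrow> real) \<Rightarrow> bool" where
  "fdd_converges M Y N X \<longleftrightarrow>
     (\<forall>S (f :: ('v \<Rightarrow> real) \<Rightarrow> real).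
        finite S \<longrightarrow>
        continuous_map (product_topology (\<lambda>_. euclideanreal) S) euclideanreal f \<longrightarrow>
        bounded (f ` (\<Pi>\<^sub>E v\<in>S. UNIV)) \<longrightarrow>
        (\<lambda>n. \<integral>\<omega>. f (\<lambda>v\<in>S. Y n v \<omega>) \<partial>M) \<longlonglongrightarrow> (\<integral>\<omega>. f (\<lambda>v\<in>S. X v \<omega>) \<partial>N))"

end

theory Submission
  imports Defs "HOL-Library.Sublist" "HOL-Real_Asymp.Real_Asymp"
begin

text \<open>The covariance of a Gaussian wave function depends only on the distance, because the
  automorphism group of the tree acts transitively on pairs of vertices at a given distance;
  by the wave equation it is therefore the spherical function \<open>\<phi>\<close>, the radial eigenfunction of
  the adjacency operator. For \<open>\<bar>\<theta>\<bar> \<le> 2 * sqrt (d - 1)\<close> the squared norm of \<open>\<phi>\<close> on the sphere of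
  radius \<open>k\<close> grows only quadratically in \<open>k\<close>, so there are radii at which the mass of the
  boundary is negligible against that of the ball. The truncations of \<open>\<phi>\<close> to these balls,
  normalised, are approximate eigenvectors, and they serve as the coefficients of the linear
  factors. By the Cauchy--Schwarz inequality the covariances of the factors satisfy the wave
  equation up to a vanishing error, hence converge to \<open>\<phi>\<close>, and for Gaussian processes convergence
  of covariances implies convergence of the finite-dimensional marginals.\<close>

section \<open>Weak convergence of Gaussian processes\<close>

text \<open>The obstacle is that the tree is not amenable: for \<open>d \<ge> 3\<close> the outer
  spheres of a ball hold a fixed fraction of its vertices, so truncation would be ruinous for a
  function of constant size. It is harmless here because the squared mass of the spherical function
  is spread almost evenly over the spheres. The range of \<open>\<theta>\<close> enters at this
  point: after scaling by \<open>sqrt (d - 1) ^ k\<close> the spherical function obeys a recurrence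
  with coefficient \<open>\<theta> / sqrt (d - 1)\<close>, which lies in \<open>[-2, 2]\<close>
  exactly in that range. A small boundary is obtained at suitable radii only: if it failed at every
  radius, the mass of the balls would grow geometrically. Both covariances are handled by the same
  lemma \<open>invariant_kernel_limit\<close>, the wave function being a constant sequence with
  error 0. On the probabilistic side the test functions are sums of phased cosines, whose Gaussian
  expectations are explicit continuous functions of the covariances.\<close>

lemma (in prob_space) centered_normal_moments:
  assumes "centered_normal M Y"
  shows "integrable M Y" "integrable M (\<lambda>\<omega>. (Y \<omega>)\<^sup>2)" "expectation Y = 0"
    and "expectation (\<lambda>\<omega>. cos (Y \<omega> + b)) = cos b * exp (- expectation (\<lambda>\<omega>. (Y \<omega>)\<^sup>2) / 2)"
proof -
  have [measurable]: "Y \<in> borel_measurable M"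
    using assms by (simp add: centered_normal_def)
  have "integrable M Y \<and> integrable M (\<lambda>\<omega>. (Y \<omega>)\<^sup>2) \<and> expectation Y = 0 \<and>
    expectation (\<lambda>\<omega>. cos (Y \<omega> + b)) = cos b * exp (- expectation (\<lambda>\<omega>. (Y \<omega>)\<^sup>2) / 2)"
  \<comment> \<open>The point mass at 0 is the case of second moment 0, where the exponential factor
    is 1. Stating the formula through the second moment and not through a standard deviation covers
    both cases.\<close>
  proof (cases "AE \<omega> in M. Y \<omega> = 0")
    case True
    have i1: "integrable M Y \<longleftrightarrow> integrable M (\<lambda>_. 0 :: real)"
      by (rule integrable_cong_AE) (use True in auto)
    have i2: "integrable M (\<lambda>\<omega>. (Y \<omega>)\<^sup>2) \<longleftrightarrow> integrable M (\<lambda>_. 0 :: real)"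
      by (rule integrable_cong_AE) (use True in auto)
    have e1: "expectation Y = expectation (\<lambda>_. 0)"
      by (rule integral_cong_AE) (use True in auto)
    have e2: "expectation (\<lambda>\<omega>. (Y \<omega>)\<^sup>2) = expectation (\<lambda>_. 0)"
      by (rule integral_cong_AE) (use True in auto)
    have e3: "expectation (\<lambda>\<omega>. cos (Y \<omega> + b)) = expectation (\<lambda>_. cos b)"
      by (rule integral_cong_AE) (use True in auto)
    show ?thesis using i1 i2 e1 e2 e3 by (simp add: prob_space)
  next
    case False
    then obtain \<sigma> where s: "\<sigma> > 0" and D: "distributed M lborel Y (normal_density 0 \<sigma>)"
      using assms by (auto simp: centered_normal_def)
    define W where "W = (\<lambda>\<omega>. Y \<omega> / \<sigma>)"
    have W: "distributed M lborel W std_normal_density"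
      using normal_standard_normal_convert[OF s, of Y 0] D by (simp add: W_def)
    have [measurable]: "W \<in> borel_measurable M" by (simp add: W_def)
    have dW: "distr M borel W = std_normal_distribution"
      using distributed_distr_eq_density[OF W] by (simp cong: distr_cong)
    have Y: "Y = (\<lambda>\<omega>. \<sigma> * W \<omega>)" using s by (auto simp: W_def)
    have i2: "integrable M (\<lambda>\<omega>. (W \<omega>)\<^sup>2)"
      using integrable_std_normal_distribution_moment[of 2] dW[symmetric]
      by (simp add: integrable_distr_eq)
    have i1: "integrable M W"
      using integrable_std_normal_distribution_moment[of 1] dW[symmetric]
      by (simp add: integrable_distr_eq)
    have e1: "expectation W = 0"
      using normal_distributed_expectation[OF _ W] by simp
    have e2: "expectation (\<lambda>\<omega>. (W \<omega>)\<^sup>2) = 1"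
      using normal_distributed_variance[OF _ W] e1 by simp
    \<comment> \<open>The cosine formula is the real part of the characteristic function at
      \<open>\<sigma>\<close>, multiplied by \<open>cis b\<close> to supply the phase.\<close>
    have "char (distr M borel W) \<sigma> = exp (- (\<sigma>\<^sup>2) / 2)"
      by (simp add: dW char_std_normal_distribution)
    then have c: "(CLINT \<omega>|M. cis (\<sigma> * W \<omega>)) = exp (- (\<sigma>\<^sup>2) / 2)"
      by (simp add: char_def integral_distr cis_conv_exp)
    have int: "complex_integrable M (\<lambda>\<omega>. cis (\<sigma> * W \<omega>))"
      by (rule integrable_const_bound[where B = 1])
        (auto intro!: borel_measurable_continuous_on[where f = cis] continuous_intros)
    have "expectation (\<lambda>\<omega>. cos (Y \<omega> + b)) = expectation (\<lambda>\<omega>. Re (cis b * cis (\<sigma> * W \<omega>)))"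
      by (intro Bochner_Integration.integral_cong)
         (auto simp: Y cos_add mult.commute)
    also have "\<dots> = Re (CLINT \<omega>|M. cis b * cis (\<sigma> * W \<omega>))"
      by (intro integral_Re integrable_mult_right int)
    also have "\<dots> = cos b * exp (- (\<sigma>\<^sup>2) / 2)"
      using c by simp
    finally have e3: "expectation (\<lambda>\<omega>. cos (Y \<omega> + b)) = cos b * exp (- (\<sigma>\<^sup>2) / 2)" .
    show ?thesis
      using i1 i2 e1 e2 e3 by (simp add: Y power_mult_distrib)
  qed
  then show "integrable M Y" "integrable M (\<lambda>\<omega>. (Y \<omega>)\<^sup>2)" "expectation Y = 0"
    and "expectation (\<lambda>\<omega>. cos (Y \<omega> + b)) = cos b * exp (- expectation (\<lambda>\<omega>. (Y \<omega>)\<^sup>2) / 2)"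
    by auto
qed

text \<open>The phase \<open>b\<close> makes constants and sines instances of the first rule. With
  it, sums of cosines form a real algebra without complex exponentials.\<close>

inductive trig_poly :: "'v set \<Rightarrow> (('v \<Rightarrow> real) \<Rightarrow> real) \<Rightarrow> bool" for S where
  cos: "trig_poly S (\<lambda>x. c * cos ((\<Sum>v\<in>S. t v * x v) + b))"
| add: "trig_poly S p \<Longrightarrow> trig_poly S q \<Longrightarrow> trig_poly S (\<lambda>x. p x + q x)"

lemma trig_poly_const: "trig_poly S (\<lambda>_. c)"
  using trig_poly.cos[of S c "\<lambda>_. 0" 0] by simp

lemma trig_poly_sin:
  assumes "finite S" "v \<in> S"
  shows "trig_poly S (\<lambda>x. sin (a * x v))"
proof -
  have "sin (a * x v) = 1 * cos ((\<Sum>w\<in>S. (if w = v then a else 0) * x w) + (- (pi / 2)))" for x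
  proof -
    have "(\<Sum>w\<in>S. (if w = v then a else 0) * x w) = (\<Sum>w\<in>S. if w = v then a * x v else 0)"
      by (intro sum.cong) auto
    then show ?thesis using assms by (simp add: cos_diff)
  qed
  then show ?thesis using trig_poly.cos[of S 1 "\<lambda>w. if w = v then a else 0" "- (pi / 2)"]
    by presburger
qed

text \<open>The product-to-sum formula: a product of two phased cosines is half the sum of the
  cosines of the difference and of the sum of the arguments.\<close>

lemma trig_poly_cos_mult:
  assumes "trig_poly S p"
  shows "trig_poly S (\<lambda>x. c * cos ((\<Sum>v\<in>S. t v * x v) + b) * p x)"
  using assms
proof induction
  case (cos c' t' b')
  have "c * cos ((\<Sum>v\<in>S. t v * x v) + b) * (c' * cos ((\<Sum>v\<in>S. t' v * x v) + b')) =
     c * c' / 2 * cos ((\<Sum>v\<in>S. (t v - t' v) * x v) + (b - b')) +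
     c * c' / 2 * cos ((\<Sum>v\<in>S. (t v + t' v) * x v) + (b + b'))" for x
  proof -
    have *: "(\<Sum>v\<in>S. (t v - t' v) * x v) + (b - b') =
        ((\<Sum>v\<in>S. t v * x v) + b) - ((\<Sum>v\<in>S. t' v * x v) + b')"
      "(\<Sum>v\<in>S. (t v + t' v) * x v) + (b + b') =
        ((\<Sum>v\<in>S. t v * x v) + b) + ((\<Sum>v\<in>S. t' v * x v) + b')"
      by (simp_all add: algebra_simps sum.distrib sum_subtractf)
    show ?thesis unfolding * cos_add[of "_ + b"] cos_diff[of "_ + b"] by (simp add: algebra_simps)
  qed
  then show ?case by (simp only:) (intro trig_poly.intros)
next
  case (add p q)
  then show ?case using trig_poly.add by (simp add: distrib_left)
qed

lemma trig_poly_mult: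
  assumes "trig_poly S p" "trig_poly S q"
  shows "trig_poly S (\<lambda>x. p x * q x)"
  using assms(1)
proof induction
  case (cos c t b)
  show ?case by (rule trig_poly_cos_mult[OF assms(2)])
next
  case (add p q)
  then show ?case using trig_poly.add by (simp add: distrib_right)
qed

lemma trig_poly_bounded:
  assumes "trig_poly S p"
  shows "\<exists>B. \<forall>x. \<bar>p x\<bar> \<le> B"
  using assms
proof induction
  case (cos c t b)
  show ?case by (rule exI[of _ "\<bar>c\<bar>"]) (auto simp: abs_mult mult_left_le)
next
  case (add p q)
  then show ?case by (metis abs_triangle_ineq add_mono order_trans)
qed

lemma trig_poly_continuous:
  assumes "trig_poly S p"
  shows "continuous_on A p"
proof -
  have "continuous_on UNIV p" using assms
  proof induction
    case (cos c t b)
    have "continuous_on UNIV (cos :: real \<Rightarrow> real)" by (intro continuous_intros)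
    then have "continuous_on UNIV (\<lambda>x. cos ((\<Sum>v\<in>S. t v * x v) + b))"
      by (rule continuous_on_compose2)
        (auto intro!: continuous_on_add continuous_on_sum continuous_on_mult)
    then show ?case by (intro continuous_on_mult continuous_on_const)
  qed (rule continuous_on_add)
  then show ?thesis by (rule continuous_on_subset) simp
qed

lemma trig_poly_measurable:
  assumes "trig_poly S p" "\<And>v. v \<in> S \<Longrightarrow> Y v \<in> borel_measurable M"
  shows "(\<lambda>\<omega>. p (\<lambda>v. Y v \<omega>)) \<in> borel_measurable M"
  using assms(1)
proof induction
  case (cos c t b)
  show ?case using assms(2) by measurable
qed (rule borel_measurable_add)

lemma trig_poly_integrable:
  assumes "finite_measure M" "trig_poly S p" "\<And>v. v \<in> S \<Longrightarrow> Y v \<in> borel_measurable M"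
  shows "integrable M (\<lambda>\<omega>. p (\<lambda>v. Y v \<omega>))"
proof -
  obtain B where "\<forall>x. \<bar>p x\<bar> \<le> B" using trig_poly_bounded[OF assms(2)] by blast
  then show ?thesis
    by (intro finite_measure.integrable_const_bound[OF assms(1), where B = B])
       (auto intro: trig_poly_measurable[OF assms(2,3)])
qed

text \<open>The map \<open>x \<mapsto> r arcsin (sin (x / r))\<close> folds the real line onto an interval and is the
  identity there. A trigonometric polynomial in the variables \<open>sin (x\<^sub>v / r)\<close> that approximates
  \<open>f\<close> on the cube therefore stays within the bounds of \<open>f\<close> outside the cube as well.\<close>

lemma trig_poly_approx_countable:
  fixes f :: "('v :: countable \<Rightarrow> real) \<Rightarrow> real"
  assumes S: "finite S"
    and f: "continuous_map (product_topology (\<lambda>_. euclideanreal) S) euclideanreal f"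
    and B: "\<And>x. \<bar>f (restrict x S)\<bar> \<le> B" and R: "R > 0" and e: "e > 0"
  obtains p where "trig_poly S p" "\<And>x. \<bar>p x\<bar> \<le> B + e"
    "\<And>x. (\<And>v. v \<in> S \<Longrightarrow> \<bar>x v\<bar> \<le> R) \<Longrightarrow> \<bar>p x - f (restrict x S)\<bar> \<le> e"
proof -
  \<comment> \<open>Coordinates outside \<open>S\<close> are pinned to 0, so that \<open>K\<close>
    is compact in the full function space and distinct points of \<open>K\<close> differ at a
    coordinate in \<open>S\<close>.\<close>
  define K where "K = (\<Pi>\<^sub>E v\<in>UNIV. if v \<in> S then {-R..R} else {0::real})"
  \<comment> \<open>With this \<open>r\<close>, the interval from \<open>-R\<close> to
    \<open>R\<close> becomes the interval from \<open>-pi/2\<close> to \<open>pi/2\<close> after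
    division by \<open>r\<close>, where \<open>sin\<close> is injective.\<close>
  define r where "r = R / (pi / 2)"
  have r: "r > 0" using R by (simp add: r_def)
  \<comment> \<open>The second condition says that \<open>p\<close> factors through the values
    \<open>sin (x v / r)\<close>. These are unchanged by folding, so a bound on \<open>K\<close> is
    a bound everywhere.\<close>
  define P where "P h \<longleftrightarrow> (\<exists>p. trig_poly S p \<and> h = p \<and> (\<forall>x y. (\<forall>v\<in>S. sin (x v / r) = sin (y v / r)) \<longrightarrow> p x = p y))"
    for h :: "('v \<Rightarrow> real) \<Rightarrow> real"
  have K: "compact K"
  proof -
    have "compactin (product_topology (\<lambda>i. euclidean) UNIV) K"
      unfolding K_def compactin_PiE by auto
    then show ?thesis unfolding euclidean_product_topology by simp
  qed
  have inj: "x = y" if xy: "\<bar>x\<bar> \<le> R" "\<bar>y\<bar> \<le> R" "sin (x / r) = sin (y / r)" for x y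
  proof -
    have "\<bar>z / r\<bar> \<le> pi / 2" if "\<bar>z\<bar> \<le> R" for z
      using that R by (auto simp: r_def field_simps abs_mult)
    from this[OF xy(1)] this[OF xy(2)] have "x / r = y / r"
      unfolding abs_le_iff using sin_inj_pi[OF _ _ _ _ xy(3)] by auto
    then show ?thesis using r by simp
  qed
  have cf: "continuous_on K (\<lambda>x. f (restrict x S))"
  proof -
    have "continuous_map euclidean (product_topology (\<lambda>_. euclideanreal) S) (\<lambda>x::'v \<Rightarrow> real. restrict x S)"
      by (auto simp: continuous_map_componentwise)
    then have "continuous_map euclidean euclideanreal (f \<circ> (\<lambda>x. restrict x S))"
      using f by (rule continuous_map_compose)
    then have "continuous_on UNIV (\<lambda>x. f (restrict x S))" by (simp add: comp_def)
    then show ?thesis by (rule continuous_on_subset) simp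
  qed
  have "\<exists>g. P g \<and> (\<forall>x\<in>K. \<bar>f (restrict x S) - g x\<bar> < e)"
  proof (rule Stone_Weierstrass_HOL[OF K])
    show "P (\<lambda>_. c)" for c unfolding P_def using trig_poly_const by blast
    show "continuous_on K g" if "P g" for g using that trig_poly_continuous by (auto simp: P_def)
    show "P (\<lambda>x. g x + h x)" if "P g \<and> P h" for g h
    proof -
      have "trig_poly S (\<lambda>x. g x + h x)" using that trig_poly.add by (auto simp: P_def)
      then show ?thesis using that unfolding P_def by metis
    qed
    show "P (\<lambda>x. g x * h x)" if "P g \<and> P h" for g h
    proof -
      have "trig_poly S (\<lambda>x. g x * h x)" using that trig_poly_mult by (auto simp: P_def)
      then show ?thesis using that unfolding P_def by metis
    qed
    show "continuous_on K (\<lambda>x. f (restrict x S))" by (rule cf)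
    show "\<exists>g. P g \<and> g x \<noteq> g y" if "x \<in> K \<and> y \<in> K \<and> x \<noteq> y" for x y
    proof -
      from that obtain v where v: "x v \<noteq> y v" by (auto simp: fun_eq_iff)
      have "x v \<in> (if v \<in> S then {-R..R} else {0})" "y v \<in> (if v \<in> S then {-R..R} else {0})"
        using that by (auto simp: K_def PiE_iff simp del: atLeastAtMost_iff)
      then have "v \<in> S" "\<bar>x v\<bar> \<le> R" "\<bar>y v\<bar> \<le> R" using v by (auto split: if_splits)
      then have "sin (x v / r) \<noteq> sin (y v / r)" using inj v by blast
      moreover have "P (\<lambda>x. sin (x v / r))"
        unfolding P_def using trig_poly_sin[OF S \<open>v \<in> S\<close>, of "1 / r"] \<open>v \<in> S\<close> by auto
      ultimately show ?thesis by blast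
    qed
  qed (rule e)
  then obtain p where p: "P p" "\<And>x. x \<in> K \<Longrightarrow> \<bar>f (restrict x S) - p x\<bar> < e" by blast
  define fold where "fold x v = (if v \<in> S then r * arcsin (sin (x v / r)) else 0)" for x :: "'v \<Rightarrow> real" and v
  have fr: "\<bar>r * arcsin (sin t)\<bar> \<le> R" for t
    using arcsin_bounded[of "sin t"] r R by (auto simp: abs_mult r_def field_simps abs_le_iff)
  have foldK: "fold x \<in> K" for x
  proof -
    have "r * arcsin (sin t) \<in> {-R..R}" for t using fr[of t] by auto
    then show ?thesis by (auto simp: fold_def K_def)
  qed
  have pfold: "p (fold x) = p x" for x
    using p(1) r by (auto simp: P_def fold_def)
  show ?thesis
  proof
    show "trig_poly S p" using p by (auto simp: P_def)
    show "\<bar>p x\<bar> \<le> B + e" for x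
      using p(2)[OF foldK, of x] B[of "fold x"] by (simp add: pfold)
    fix x assume x: "\<And>v. v \<in> S \<Longrightarrow> \<bar>x v\<bar> \<le> R"
    have "fold x v = x v" if "v \<in> S" for v
      using inj[OF fr x[OF that], of "x v / r"] r that by (simp add: fold_def)
    then have "restrict (fold x) S = restrict x S" by auto
    then show "\<bar>p x - f (restrict x S)\<bar> \<le> e"
      using p(2)[OF foldK, of x] by (simp add: pfold)
  qed
qed

lemma trig_poly_reindex:
  assumes "bij_betw h I S" "trig_poly I p"
  shows "trig_poly S (\<lambda>x. p (\<lambda>i. x (h i)))"
  using assms(2)
proof induction
  case (cos c t b)
  have "(\<Sum>i\<in>I. t i * x (h i)) = (\<Sum>v\<in>S. t (inv_into I h v) * x v)" for x
    using assms(1) by (intro sum.reindex_bij_witness[of _ "inv_into I h" h])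
      (auto simp: bij_betw_inv_into_left bij_betw_inv_into_right bij_betwE bij_betw_def inv_into_into)
  then show ?case by (simp add: trig_poly.cos)
next
  case (add p q)
  show ?case by (rule trig_poly.add[OF add.IH])
qed

text \<open>The Stone--Weierstrass theorem of the library needs a Hausdorff type, and function types
  have that instance only for countable index types.\<close>

lemma trig_poly_approx:
  fixes f :: "('v \<Rightarrow> real) \<Rightarrow> real"
  assumes S: "finite S"
    and f: "continuous_map (product_topology (\<lambda>_. euclideanreal) S) euclideanreal f"
    and B: "\<And>x. \<bar>f (restrict x S)\<bar> \<le> B" and R: "R > 0" and e: "e > 0"
  obtains p where "trig_poly S p" "\<And>x. \<bar>p x\<bar> \<le> B + e"
    "\<And>x. (\<And>v. v \<in> S \<Longrightarrow> \<bar>x v\<bar> \<le> R) \<Longrightarrow> \<bar>p x - f (restrict x S)\<bar> \<le> e"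
proof -
  obtain h where h: "bij_betw h {..<card S} S"
    using ex_bij_betw_nat_finite[OF S] by (auto simp: atLeast0LessThan)
  define I where "I = {..<card S}"
  define k where "k = inv_into I h"
  define f' where "f' y = f (\<lambda>v\<in>S. y (k v))" for y :: "nat \<Rightarrow> real"
  have kI: "k v \<in> I" "h (k v) = v" if "v \<in> S" for v
    using h that inv_into_into[of v h I] by (auto simp: k_def I_def bij_betw_def f_inv_into_f)
  have f'r: "f' (restrict y I) = f (\<lambda>v\<in>S. y (k v))" for y
    unfolding f'_def using kI by (intro arg_cong[where f = f]) auto
  have f': "continuous_map (product_topology (\<lambda>_. euclideanreal) I) euclideanreal f'"
  proof -
    have "continuous_map (product_topology (\<lambda>_. euclideanreal) I) (product_topology (\<lambda>_. euclideanreal) S)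
        (\<lambda>y. \<lambda>v\<in>S. y (k v))"
      using kI by (auto simp: continuous_map_componentwise intro!: continuous_map_product_coordinates)
    from continuous_map_compose[OF this f] show ?thesis
      by (simp add: comp_def f'_def[abs_def])
  qed
  have "\<bar>f' (restrict y I)\<bar> \<le> B" for y
    unfolding f'r by (rule B)
  then obtain p where p: "trig_poly I p" "\<And>x. \<bar>p x\<bar> \<le> B + e"
    "\<And>x. (\<And>v. v \<in> I \<Longrightarrow> \<bar>x v\<bar> \<le> R) \<Longrightarrow> \<bar>p x - f' (restrict x I)\<bar> \<le> e"
    using trig_poly_approx_countable[OF _ f' _ R e, of B] unfolding I_def by blast
  show ?thesis
  proof
    show "trig_poly S (\<lambda>x. p (\<lambda>i. x (h i)))"
      using trig_poly_reindex[OF h] p(1) unfolding I_def by blast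
    show "\<bar>p (\<lambda>i. x (h i))\<bar> \<le> B + e" for x by (rule p(2))
    fix x assume "\<And>v. v \<in> S \<Longrightarrow> \<bar>x v\<bar> \<le> R"
    then have "\<bar>p (\<lambda>i. x (h i)) - f' (restrict (\<lambda>i. x (h i)) I)\<bar> \<le> e"
      using h by (intro p(3)) (auto simp: I_def bij_betw_def)
    also have "f' (restrict (\<lambda>i. x (h i)) I) = f (restrict x S)"
      unfolding f'r using kI by (intro arg_cong[where f = f]) auto
    finally show "\<bar>p (\<lambda>i. x (h i)) - f (restrict x S)\<bar> \<le> e" .
  qed
qed

section \<open>Second moments of Gaussian processes and the convergence criterion\<close>

lemma gaussian_process_centered_normal:
  assumes "gaussian_process M X"
  shows "centered_normal M (X v)"
  using assms[unfolded gaussian_process_def, THEN conjunct2, rule_format, of "{v}" "\<lambda>_. 1"] by simp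

lemma gaussian_process_integrable_mult:
  assumes X: "gaussian_process M X"
  shows "integrable M (\<lambda>\<omega>. X u \<omega> * X v \<omega>)"
proof -
  interpret prob_space M using X by (simp add: gaussian_process_def)
  have [measurable]: "X v \<in> borel_measurable M" for v
    using gaussian_process_centered_normal[OF X] by (simp add: centered_normal_def)
  show ?thesis
  proof (rule Bochner_Integration.integrable_bound)
    show "integrable M (\<lambda>\<omega>. (X u \<omega>)\<^sup>2 + (X v \<omega>)\<^sup>2)"
      using centered_normal_moments(2)[OF gaussian_process_centered_normal[OF X]] by simp
    have "\<bar>a * b\<bar> \<le> a\<^sup>2 + b\<^sup>2" for a b :: real
    proof -
      have "2 * (\<bar>a\<bar> * \<bar>b\<bar>) \<le> a\<^sup>2 + b\<^sup>2" "0 \<le> \<bar>a\<bar> * \<bar>b\<bar>"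
        using sum_squares_bound[of "\<bar>a\<bar>" "\<bar>b\<bar>"] by simp_all
      then show ?thesis unfolding abs_mult by linarith
    qed
    then show "AE \<omega> in M. norm (X u \<omega> * X v \<omega>) \<le> norm ((X u \<omega>)\<^sup>2 + (X v \<omega>)\<^sup>2)"
      by (intro AE_I2) simp
  qed simp
qed

text \<open>For trigonometric polynomials the expectations converge because they depend continuously
  on the covariances. A general \<open>f\<close> is replaced by such polynomials on growing cubes;
  the mass outside a cube is controlled by the variances, which are bounded because they
  converge.\<close>

lemma gaussian_fdd_converges:
  fixes Y :: "nat \<Rightarrow> 'v \<Rightarrow> 'a \<Rightarrow> real" and X :: "'v \<Rightarrow> 'b \<Rightarrow> real"
  assumes Y: "\<And>n. gaussian_process M (Y n)" and X: "gaussian_process N X"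
    and cov: "\<And>u v. (\<lambda>n. \<integral>\<omega>. Y n u \<omega> * Y n v \<omega> \<partial>M) \<longlonglongrightarrow> (\<integral>\<omega>. X u \<omega> * X v \<omega> \<partial>N)"
  shows "fdd_converges M Y N X"
  unfolding fdd_converges_def
proof (intro allI impI)
  fix S and f :: "('v \<Rightarrow> real) \<Rightarrow> real"
  assume S: "finite S"
    and f: "continuous_map (product_topology (\<lambda>_. euclideanreal) S) euclideanreal f"
    and bf: "bounded (f ` (\<Pi>\<^sub>E v\<in>S. UNIV))"
  obtain B where "\<And>y. y \<in> f ` (\<Pi>\<^sub>E v\<in>S. UNIV) \<Longrightarrow> norm y \<le> B"
    using bf unfolding bounded_iff by blast
  then have B: "\<bar>f (restrict x S)\<bar> \<le> B" for x by simp
  then have B0: "B \<ge> 0" by (meson abs_ge_zero order_trans)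
  define r where "r m = real (Suc m)" for m
  define \<epsilon> where "\<epsilon> m = 1 / real (Suc m)" for m
  have e1: "0 < \<epsilon> m" "\<epsilon> m \<le> 1" "r m > 0" "\<epsilon> m = 1 / r m" for m by (auto simp: \<epsilon>_def r_def)
  have "\<exists>p. trig_poly S p \<and> (\<forall>x. \<bar>p x\<bar> \<le> B + \<epsilon> m) \<and>
    (\<forall>x. (\<forall>v\<in>S. \<bar>x v\<bar> \<le> r m) \<longrightarrow> \<bar>p x - f (restrict x S)\<bar> \<le> \<epsilon> m)" for m
    using trig_poly_approx[OF S f B e1(3) e1(1)] by metis
  then obtain p where p: "\<And>m. trig_poly S (p m)" "\<And>m x. \<bar>p m x\<bar> \<le> B + \<epsilon> m"
    "\<And>m x. (\<And>v. v \<in> S \<Longrightarrow> \<bar>x v\<bar> \<le> r m) \<Longrightarrow> \<bar>p m x - f (restrict x S)\<bar> \<le> \<epsilon> m"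
    by metis
  \<comment> \<open>A pointwise Chebyshev inequality: outside the cube some term of the sum is at
    least 1, while the difference is at most \<open>2 * B + \<epsilon> m\<close>, hence at most
    \<open>2 * B + 1\<close>.\<close>
  have close: "\<bar>p m x - f (restrict x S)\<bar> \<le> \<epsilon> m + (2 * B + 1) * (\<Sum>v\<in>S. (\<epsilon> m * x v)\<^sup>2)" for m x
  proof (cases "\<forall>v\<in>S. \<bar>x v\<bar> \<le> r m")
    case True
    then have "\<bar>p m x - f (restrict x S)\<bar> \<le> \<epsilon> m" using p(3) by blast
    moreover have "0 \<le> (2 * B + 1) * (\<Sum>v\<in>S. (\<epsilon> m * x v)\<^sup>2)" using B0 by (simp add: sum_nonneg)
    ultimately show ?thesis by linarith
  next
    case False
    then obtain v where v: "v \<in> S" "\<bar>x v\<bar> > r m" by force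
    have "\<bar>\<epsilon> m * x v\<bar> \<ge> 1"
      using v(2) e1(3)[of m] unfolding e1(4) by (simp add: abs_mult field_simps)
    then have "1 \<le> (\<epsilon> m * x v)\<^sup>2" by (metis abs_le_square_iff abs_one one_power2)
    also have "\<dots> \<le> (\<Sum>v\<in>S. (\<epsilon> m * x v)\<^sup>2)" using v S by (intro member_le_sum) auto
    finally have T: "1 \<le> (\<Sum>v\<in>S. (\<epsilon> m * x v)\<^sup>2)" .
    have "\<bar>p m x - f (restrict x S)\<bar> \<le> (2 * B + 1) * 1"
      using p(2)[of m x] B[of x] e1(2)[of m] by simp
    also have "\<dots> \<le> (2 * B + 1) * (\<Sum>v\<in>S. (\<epsilon> m * x v)\<^sup>2)"
      using B0 T by (intro mult_left_mono) auto
    finally show ?thesis using e1(1)[of m] by simp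
  qed
  have eps0: "\<epsilon> \<longlonglongrightarrow> 0"
    unfolding \<epsilon>_def using LIMSEQ_inverse_real_of_nat by (simp add: inverse_eq_divide)

  have approx: "\<bar>(\<integral>\<omega>. f (\<lambda>v\<in>S. W v \<omega>) \<partial>M') - (\<integral>\<omega>. p m (\<lambda>v. W v \<omega>) \<partial>M')\<bar>
      \<le> \<epsilon> m + (2 * B + 1) * (\<epsilon> m)\<^sup>2 * (\<Sum>v\<in>S. \<integral>\<omega>. W v \<omega> * W v \<omega> \<partial>M')"
    if W: "gaussian_process M' W" for M' :: "'c measure" and W m
  proof -
    interpret prob_space M' using W by (simp add: gaussian_process_def)
    note cn = centered_normal_moments[OF gaussian_process_centered_normal[OF W]]
    have [measurable]: "W v \<in> borel_measurable M'" for v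
      using gaussian_process_centered_normal[OF W] by (simp add: centered_normal_def)
    \<comment> \<open>Continuity of \<open>f\<close> is given in the product topology on
      \<open>S\<close>; measurability of the composition follows because it is a pointwise limit of
      the approximating polynomials.\<close>
    have fm: "(\<lambda>\<omega>. f (\<lambda>v\<in>S. W v \<omega>)) \<in> borel_measurable M'"
    proof (rule borel_measurable_LIMSEQ_real)
      show "(\<lambda>\<omega>. p i (\<lambda>v. W v \<omega>)) \<in> borel_measurable M'" for i
        by (rule trig_poly_measurable[OF p(1)]) simp
      show "(\<lambda>i. p i (\<lambda>v. W v \<omega>)) \<longlonglongrightarrow> f (\<lambda>v\<in>S. W v \<omega>)" for \<omega>
      proof (rule Lim_transform2[OF tendsto_const], rule Lim_null_comparison)
        show "\<forall>\<^sub>F i in sequentially. norm (f (\<lambda>v\<in>S. W v \<omega>) - p i (\<lambda>v. W v \<omega>))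
          \<le> \<epsilon> i + (2 * B + 1) * (\<Sum>v\<in>S. (\<epsilon> i * W v \<omega>)\<^sup>2)"
          using close by (intro always_eventually allI) (simp add: abs_minus_commute)
        have "(\<lambda>i. \<epsilon> i + (2 * B + 1) * (\<Sum>v\<in>S. (\<epsilon> i * W v \<omega>)\<^sup>2))
          \<longlonglongrightarrow> 0 + (2 * B + 1) * (\<Sum>v\<in>S. (0 * W v \<omega>)\<^sup>2)"
          by (intro tendsto_intros eps0)
        then show "(\<lambda>i. \<epsilon> i + (2 * B + 1) * (\<Sum>v\<in>S. (\<epsilon> i * W v \<omega>)\<^sup>2)) \<longlonglongrightarrow> 0" by simp
      qed
    qed
    have fi: "integrable M' (\<lambda>\<omega>. f (\<lambda>v\<in>S. W v \<omega>))"
      by (rule integrable_const_bound[where B = B]) (use fm B in auto)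
    have pI: "integrable M' (\<lambda>\<omega>. p m (\<lambda>v. W v \<omega>))"
      by (rule trig_poly_integrable[OF finite_measure_axioms p(1)]) simp
    have i2: "integrable M' (\<lambda>\<omega>. (\<epsilon> m * W v \<omega>)\<^sup>2)" for v
      using cn(2)[of v] by (simp add: power_mult_distrib)
    have "\<bar>(\<integral>\<omega>. f (\<lambda>v\<in>S. W v \<omega>) \<partial>M') - (\<integral>\<omega>. p m (\<lambda>v. W v \<omega>) \<partial>M')\<bar>
      = \<bar>\<integral>\<omega>. f (\<lambda>v\<in>S. W v \<omega>) - p m (\<lambda>v. W v \<omega>) \<partial>M'\<bar>"
      by (simp add: Bochner_Integration.integral_diff[OF fi pI])
    also have "\<dots> \<le> (\<integral>\<omega>. \<bar>f (\<lambda>v\<in>S. W v \<omega>) - p m (\<lambda>v. W v \<omega>)\<bar> \<partial>M')"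
      by (rule integral_abs_bound)
    also have "\<dots> \<le> (\<integral>\<omega>. \<epsilon> m + (2 * B + 1) * (\<Sum>v\<in>S. (\<epsilon> m * W v \<omega>)\<^sup>2) \<partial>M')"
      using fi pI i2 close by (intro integral_mono) (auto simp: abs_minus_commute)
    also have "\<dots> = \<epsilon> m + (2 * B + 1) * (\<Sum>v\<in>S. \<integral>\<omega>. (\<epsilon> m * W v \<omega>)\<^sup>2 \<partial>M')"
      using i2 by (simp add: prob_space)
    finally show ?thesis
      by (simp add: power_mult_distrib sum_distrib_left power2_eq_square mult_ac)
  qed

  have second: "(\<integral>\<omega>. (\<Sum>v\<in>S. t v * W v \<omega>)\<^sup>2 \<partial>M') = (\<Sum>u\<in>S. \<Sum>v\<in>S. t u * t v * (\<integral>\<omega>. W u \<omega> * W v \<omega> \<partial>M'))"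
    if W: "gaussian_process M' W" for M' :: "'c measure" and W t
  proof -
    interpret prob_space M' using W by (simp add: gaussian_process_def)
    note cn = centered_normal_moments[OF gaussian_process_centered_normal[OF W]]
    have [measurable]: "W v \<in> borel_measurable M'" for v
      using gaussian_process_centered_normal[OF W] by (simp add: centered_normal_def)
    show ?thesis using gaussian_process_integrable_mult[OF W]
      by (simp add: power2_eq_square sum_product mult_ac)
  qed
  have trig_lim: "(\<lambda>n. \<integral>\<omega>. q (\<lambda>v. Y n v \<omega>) \<partial>M) \<longlonglongrightarrow> (\<integral>\<omega>. q (\<lambda>v. X v \<omega>) \<partial>N)" if "trig_poly S q" for q
    using that
  proof induction
    case (cos c t b)
    have *: "(\<integral>\<omega>. c * cos ((\<Sum>v\<in>S. t v * W v \<omega>) + b) \<partial>M') =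
       c * (cos b * exp (- (\<Sum>u\<in>S. \<Sum>v\<in>S. t u * t v * (\<integral>\<omega>. W u \<omega> * W v \<omega> \<partial>M')) / 2))"
      if W: "gaussian_process M' W" for M' :: "'c measure" and W
    proof -
      interpret prob_space M' using W by (simp add: gaussian_process_def)
      have "centered_normal M' (\<lambda>\<omega>. \<Sum>v\<in>S. t v * W v \<omega>)"
        using W S by (simp add: gaussian_process_def)
      from centered_normal_moments(4)[OF this, of b] show ?thesis
        by (simp add: second[OF W])
    qed
    show ?case unfolding *[OF Y] *[OF X] by (intro tendsto_intros cov) simp
  next
    case (add q q')
    have *: "(\<integral>\<omega>. q (\<lambda>v. W v \<omega>) + q' (\<lambda>v. W v \<omega>) \<partial>M') =
      (\<integral>\<omega>. q (\<lambda>v. W v \<omega>) \<partial>M') + (\<integral>\<omega>. q' (\<lambda>v. W v \<omega>) \<partial>M')"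
      if W: "gaussian_process M' W" for M' :: "'c measure" and W
    proof -
      interpret prob_space M' using W by (simp add: gaussian_process_def)
      have "W v \<in> borel_measurable M'" for v
        using gaussian_process_centered_normal[OF W] by (simp add: centered_normal_def)
      then show ?thesis
        using trig_poly_integrable[OF finite_measure_axioms] add.hyps
        by (intro Bochner_Integration.integral_add) blast+
    qed
    show ?case unfolding *[OF Y] *[OF X] by (intro tendsto_add add.IH)
  qed

  define C where "C n = (\<Sum>v\<in>S. \<integral>\<omega>. Y n v \<omega> * Y n v \<omega> \<partial>M)" for n
  define D where "D = (\<Sum>v\<in>S. \<integral>\<omega>. X v \<omega> * X v \<omega> \<partial>N)"
  have CD: "C \<longlonglongrightarrow> D" unfolding C_def D_def by (intro tendsto_sum cov)
  then obtain K where K: "\<And>n. \<bar>C n\<bar> \<le> K"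
    using convergent_imp_Bseq[of C] by (auto simp: convergent_def Bseq_def)
  \<comment> \<open>The approximation error is paid once for \<open>Y n\<close> and once for
    \<open>X\<close>. As \<open>K\<close> bounds the summed variances for all \<open>n\<close>, this
    error depends on \<open>m\<close> alone, and \<open>m\<close> can be fixed before
    \<open>n\<close>.\<close>
  define \<delta> where "\<delta> m = 2 * \<epsilon> m + (2 * B + 1) * (\<epsilon> m)\<^sup>2 * (K + \<bar>D\<bar>)" for m
  have d0: "\<delta> \<longlonglongrightarrow> 0"
  proof -
    have "\<delta> \<longlonglongrightarrow> 2 * 0 + (2 * B + 1) * 0\<^sup>2 * (K + \<bar>D\<bar>)"
      unfolding \<delta>_def by (intro tendsto_intros eps0)
    then show ?thesis by simp
  qed
  have main: "\<bar>(\<integral>\<omega>. f (\<lambda>v\<in>S. Y n v \<omega>) \<partial>M) - (\<integral>\<omega>. f (\<lambda>v\<in>S. X v \<omega>) \<partial>N)\<bar>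
    \<le> \<bar>(\<integral>\<omega>. p m (\<lambda>v. Y n v \<omega>) \<partial>M) - (\<integral>\<omega>. p m (\<lambda>v. X v \<omega>) \<partial>N)\<bar> + \<delta> m" for n m
  proof -
    have "(2 * B + 1) * (\<epsilon> m)\<^sup>2 * C n \<le> (2 * B + 1) * (\<epsilon> m)\<^sup>2 * K"
      using K[of n] B0 by (intro mult_left_mono) auto
    moreover have "(2 * B + 1) * (\<epsilon> m)\<^sup>2 * D \<le> (2 * B + 1) * (\<epsilon> m)\<^sup>2 * \<bar>D\<bar>"
      using B0 by (intro mult_left_mono) auto
    ultimately show ?thesis
      using approx[OF Y[of n], of m] approx[OF X, of m] unfolding C_def[symmetric] D_def[symmetric]
      by (simp add: \<delta>_def distrib_left)
  qed
  show "(\<lambda>n. \<integral>\<omega>. f (\<lambda>v\<in>S. Y n v \<omega>) \<partial>M) \<longlonglongrightarrow> (\<integral>\<omega>. f (\<lambda>v\<in>S. X v \<omega>) \<partial>N)"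
  proof (rule LIMSEQ_I)
    fix e :: real assume "e > 0"
    then have "\<forall>\<^sub>F m in sequentially. \<delta> m < e / 2"
      by (intro order_tendstoD(2)[OF d0]) simp
    then obtain m where m: "\<delta> m < e / 2" by (auto simp: eventually_sequentially)
    obtain n0 where "\<forall>n\<ge>n0. norm ((\<integral>\<omega>. p m (\<lambda>v. Y n v \<omega>) \<partial>M) - (\<integral>\<omega>. p m (\<lambda>v. X v \<omega>) \<partial>N)) < e / 2"
      using LIMSEQ_D[OF trig_lim[OF p(1)[of m]], of "e / 2"] \<open>e > 0\<close> by auto
    then show "\<exists>n0. \<forall>n\<ge>n0. norm ((\<integral>\<omega>. f (\<lambda>v\<in>S. Y n v \<omega>) \<partial>M) - (\<integral>\<omega>. f (\<lambda>v\<in>S. X v \<omega>) \<partial>N)) < e"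
      using main[of _ m] m by (intro exI[of _ n0]) (fastforce intro: le_less_trans)
  qed
qed

section \<open>Finite linear combinations of i.i.d. normal variables\<close>

lemma iid_std_normal_moments:
  assumes M: "prob_space M" and Z: "iid_std_normal M Z"
  shows "integrable M (\<lambda>\<omega>. Z u \<omega> * Z v \<omega>)"
    and "(\<integral>\<omega>. Z u \<omega> * Z v \<omega> \<partial>M) = (if u = v then 1 else 0)"
proof -
  interpret prob_space M by fact
  have D: "distributed M lborel (Z v) std_normal_density" for v
    using Z by (simp add: iid_std_normal_def)
  then have c: "centered_normal M (Z v)" for v
    unfolding centered_normal_def using distributed_measurable[OF D]
    by (intro conjI disjI2 exI[of _ 1]) auto
  have ind: "indep_vars (\<lambda>_. borel) Z {u, v}"
    using Z indep_vars_subset[where M' = "\<lambda>_. borel" and X = Z and I = UNIV] by (auto simp: iid_std_normal_def)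
  have "integrable M (\<lambda>\<omega>. Z u \<omega> * Z v \<omega>) \<and> expectation (\<lambda>\<omega>. Z u \<omega> * Z v \<omega>) = (if u = v then 1 else 0)"
  proof (cases "u = v")
    case True
    have "expectation (\<lambda>\<omega>. (Z u \<omega>)\<^sup>2) = 1"
      using normal_distributed_variance[OF _ D[of u]] centered_normal_moments(3)[OF c[of u]] by simp
    then show ?thesis using True centered_normal_moments(2)[OF c[of u]] by (simp add: power2_eq_square)
  next
    case False
    then have "(\<lambda>\<omega>. Z u \<omega> * Z v \<omega>) = (\<lambda>\<omega>. \<Prod>i\<in>{u, v}. Z i \<omega>)" by auto
    moreover have "integrable M (\<lambda>\<omega>. \<Prod>i\<in>{u, v}. Z i \<omega>)"
      by (intro indep_vars_integrable ind centered_normal_moments(1)[OF c]) auto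
    moreover have "expectation (\<lambda>\<omega>. \<Prod>i\<in>{u, v}. Z i \<omega>) = (\<Prod>i\<in>{u, v}. expectation (Z i))"
      by (intro indep_vars_lebesgue_integral ind centered_normal_moments(1)[OF c]) auto
    ultimately show ?thesis using False centered_normal_moments(3)[OF c] by simp
  qed
  then show "integrable M (\<lambda>\<omega>. Z u \<omega> * Z v \<omega>)"
    and "(\<integral>\<omega>. Z u \<omega> * Z v \<omega> \<partial>M) = (if u = v then 1 else 0)"
    by auto
qed

lemma iid_std_normal_sum:
  assumes M: "prob_space M" and Z: "iid_std_normal M Z" and B: "finite B"
  shows "centered_normal M (\<lambda>\<omega>. \<Sum>w\<in>B. a w * Z w \<omega>)"
proof -
  interpret prob_space M by fact
  have D: "distributed M lborel (Z v) std_normal_density" for v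
    using Z by (simp add: iid_std_normal_def)
  have [measurable]: "Z v \<in> borel_measurable M" for v
    using distributed_measurable[OF D] by simp
  \<comment> \<open>Zero coefficients are dropped because each summand needs a density with positive
    deviation; if nothing remains, the sum is the degenerate normal variable 0.\<close>
  define B' where "B' = {w\<in>B. a w \<noteq> 0}"
  have eq: "(\<Sum>w\<in>B. a w * Z w \<omega>) = (\<Sum>w\<in>B'. a w * Z w \<omega>)" for \<omega>
    using B by (intro sum.mono_neutral_right) (auto simp: B'_def)
  show ?thesis
  proof (cases "B' = {}")
    case True
    then show ?thesis unfolding eq by (simp add: centered_normal_def)
  next
    case False
    have ind: "indep_vars (\<lambda>_. borel) (\<lambda>w \<omega>. a w * Z w \<omega>) B'"
    proof (rule indep_vars_compose2[where M' = "\<lambda>_. borel" and Y = "\<lambda>w x. a w * x"])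
      show "indep_vars (\<lambda>_. borel) Z B'"
        using Z indep_vars_subset[where M' = "\<lambda>_. borel" and X = Z and I = UNIV] by (auto simp: iid_std_normal_def)
    qed simp
    have "distributed M lborel (\<lambda>\<omega>. a w * Z w \<omega>) (normal_density 0 \<bar>a w\<bar>)" if "w \<in> B'" for w
      using normal_density_affine[OF D[of w], of "a w" 0] that by (simp add: B'_def)
    then have "distributed M lborel (\<lambda>\<omega>. \<Sum>w\<in>B'. a w * Z w \<omega>)
        (normal_density (\<Sum>w\<in>B'. 0) (sqrt (\<Sum>w\<in>B'. \<bar>a w\<bar>\<^sup>2)))"
      using B False by (intro sum_indep_normal ind) (auto simp: B'_def)
    moreover have "(\<Sum>w\<in>B'. \<bar>a w\<bar>\<^sup>2) > 0"
      using B False by (intro sum_pos) (auto simp: B'_def)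
    ultimately show ?thesis
      unfolding eq centered_normal_def
      by (intro conjI disjI2 exI[of _ "sqrt (\<Sum>w\<in>B'. \<bar>a w\<bar>\<^sup>2)"]) auto
  qed
qed

text \<open>Since coefficients vanish off \<open>F v\<close>, all sums can be taken over a common
  finite set, where orthonormality of the \<open>Z w\<close> applies. This is also why the
  covariance may be summed over \<open>F u\<close> alone.\<close>

lemma linear_process:
  fixes Z :: "'w \<Rightarrow> 'a \<Rightarrow> real" and a :: "'v \<Rightarrow> 'w \<Rightarrow> real"
  assumes M: "prob_space M" and Z: "iid_std_normal M Z"
    and F: "\<And>v. finite (F v)" "\<And>v w. w \<notin> F v \<Longrightarrow> a v w = 0"
  shows "gaussian_process M (\<lambda>v \<omega>. \<Sum>w\<in>F v. a v w * Z w \<omega>)"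
    and "(\<integral>\<omega>. (\<Sum>w\<in>F u. a u w * Z w \<omega>) * (\<Sum>w\<in>F v. a v w * Z w \<omega>) \<partial>M) = (\<Sum>w\<in>F u. a u w * a v w)"
proof -
  have ext: "(\<Sum>w\<in>F v. a v w * Z w \<omega>) = (\<Sum>w\<in>B. a v w * Z w \<omega>)" if "finite B" "F v \<subseteq> B" for v B \<omega>
    using that F(2) by (intro sum.mono_neutral_left) auto
  show "gaussian_process M (\<lambda>v \<omega>. \<Sum>w\<in>F v. a v w * Z w \<omega>)"
    unfolding gaussian_process_def
  proof (intro conjI allI impI M)
    fix S :: "'v set" and c :: "'v \<Rightarrow> real" assume S: "finite S"
    define B where "B = (\<Union>v\<in>S. F v)"
    have B: "finite B" using S F(1) by (auto simp: B_def)
    have "(\<Sum>v\<in>S. c v * (\<Sum>w\<in>F v. a v w * Z w \<omega>)) = (\<Sum>w\<in>B. (\<Sum>v\<in>S. c v * a v w) * Z w \<omega>)" for \<omega>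
    proof -
      have "c v * (\<Sum>w\<in>F v. a v w * Z w \<omega>) = (\<Sum>w\<in>B. c v * a v w * Z w \<omega>)" if "v \<in> S" for v
        using ext[OF B, of v \<omega>] that by (simp add: B_def UN_upper sum_distrib_left mult.assoc)
      then have "(\<Sum>v\<in>S. c v * (\<Sum>w\<in>F v. a v w * Z w \<omega>)) = (\<Sum>v\<in>S. \<Sum>w\<in>B. c v * a v w * Z w \<omega>)"
        by simp
      also have "\<dots> = (\<Sum>w\<in>B. \<Sum>v\<in>S. c v * a v w * Z w \<omega>)" by (rule sum.swap)
      finally show ?thesis by (simp add: sum_distrib_right)
    qed
    then show "centered_normal M (\<lambda>\<omega>. \<Sum>v\<in>S. c v * (\<Sum>w\<in>F v. a v w * Z w \<omega>))"
      using iid_std_normal_sum[OF M Z B] by simp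
  qed
  define B where "B = F u \<union> F v"
  have B: "finite B" "F u \<subseteq> B" "F v \<subseteq> B" using F(1) by (auto simp: B_def)
  have "(\<integral>\<omega>. (\<Sum>w\<in>B. a u w * Z w \<omega>) * (\<Sum>w\<in>B. a v w * Z w \<omega>) \<partial>M) =
      (\<integral>\<omega>. (\<Sum>w\<in>B. \<Sum>w'\<in>B. a u w * a v w' * (Z w \<omega> * Z w' \<omega>)) \<partial>M)"
    by (simp add: sum_product mult_ac)
  also have "\<dots> = (\<Sum>w\<in>B. \<Sum>w'\<in>B. a u w * a v w' * (if w = w' then 1 else 0))"
    by (simp add: iid_std_normal_moments[OF M Z])
  also have "\<dots> = (\<Sum>w\<in>B. a u w * a v w)"
    using B by (simp add: if_distrib[of "(*) _"] cong: if_cong)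
  also have "\<dots> = (\<Sum>w\<in>F u. a u w * a v w)"
    using B F by (intro sum.mono_neutral_right) auto
  finally show "(\<integral>\<omega>. (\<Sum>w\<in>F u. a u w * Z w \<omega>) * (\<Sum>w\<in>F v. a v w * Z w \<omega>) \<partial>M) = (\<Sum>w\<in>F u. a u w * a v w)"
    by (simp add: ext[OF B(1,2)] ext[OF B(1,3)])
qed

section \<open>The spherical function\<close>

text \<open>The radial eigenfunction of the adjacency operator with value \<open>1\<close> at the root.\<close>

fun spherical :: "nat \<Rightarrow> real \<Rightarrow> nat \<Rightarrow> real" where
  "spherical d \<theta> 0 = 1"
| "spherical d \<theta> (Suc 0) = \<theta> / real d"
| "spherical d \<theta> (Suc (Suc k)) = (\<theta> * spherical d \<theta> (Suc k) - spherical d \<theta> k) / (real d - 1)"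

text \<open>The squared norm of the radial eigenfunction on the sphere of radius \<open>k\<close>.\<close>

definition spherical_mass :: "nat \<Rightarrow> real \<Rightarrow> nat \<Rightarrow> real" where
  "spherical_mass d \<theta> k = (if k = 0 then 1 else real d * (real d - 1) ^ (k - 1)) * (spherical d \<theta> k)\<^sup>2"

text \<open>For \<open>\<bar>t\<bar> \<le> 2\<close> the quadratic form \<open>x\<^sup>2 - t x y + y\<^sup>2\<close> is positive semidefinite, and it is
  invariant under the recurrence.\<close>

lemma linear_recurrence_bound:
  fixes b :: "nat \<Rightarrow> real"
  assumes b: "\<And>k. b (Suc (Suc k)) = t * b (Suc k) - b k" and t: "\<bar>t\<bar> \<le> 2"
  obtains C where "\<And>k. \<bar>b k\<bar> \<le> C * (real k + 1)"
proof -
  define E where "E k = (b (Suc k))\<^sup>2 - t * b k * b (Suc k) + (b k)\<^sup>2" for k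
  have "E (Suc k) = E k" for k
    unfolding E_def b by (simp add: power2_eq_square algebra_simps)
  then have E: "E k = E 0" for k by (induction k) auto
  have step: "\<bar>b (Suc k)\<bar> \<le> \<bar>b k\<bar> + sqrt (E 0)" for k
  proof -
    have "t\<^sup>2 \<le> 2\<^sup>2" using t by (metis abs_le_square_iff abs_numeral)
    then have "0 \<le> (1 - t\<^sup>2 / 4) * (b k)\<^sup>2" by simp
    \<comment> \<open>Completing the square: the subtracted term is nonnegative because
      \<open>\<bar>t\<bar> \<le> 2\<close>, so each step adds at most \<open>sqrt (E 0)\<close> to
      \<open>\<bar>b k\<bar>\<close>.\<close>
    moreover have "(b (Suc k) - t / 2 * b k)\<^sup>2 = E k - (1 - t\<^sup>2 / 4) * (b k)\<^sup>2"
      unfolding E_def by (simp add: power2_eq_square algebra_simps)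
    ultimately have "(b (Suc k) - t / 2 * b k)\<^sup>2 \<le> E 0" using E[of k] by linarith
    then have "\<bar>b (Suc k) - t / 2 * b k\<bar> \<le> sqrt (E 0)"
      using real_sqrt_le_mono by fastforce
    moreover have "\<bar>t / 2 * b k\<bar> \<le> \<bar>b k\<bar>"
      using mult_right_mono[OF t, of "\<bar>b k\<bar>"] by (simp add: abs_mult)
    ultimately show ?thesis by linarith
  qed
  have E0: "0 \<le> sqrt (E 0)"
  proof -
    have "E 0 = (b 1 - t / 2 * b 0)\<^sup>2 + (1 - t\<^sup>2 / 4) * (b 0)\<^sup>2"
      unfolding E_def by (simp add: power2_eq_square algebra_simps)
    moreover have "t\<^sup>2 \<le> 2\<^sup>2" using t by (metis abs_le_square_iff abs_numeral)
    ultimately show ?thesis by simp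
  qed
  have "\<bar>b k\<bar> \<le> \<bar>b 0\<bar> + real k * sqrt (E 0)" for k
  proof (induction k)
    case (Suc k)
    then show ?case using step[of k] by (simp add: algebra_simps)
  qed simp
  moreover have "\<bar>b 0\<bar> + real k * sqrt (E 0) \<le> (\<bar>b 0\<bar> + sqrt (E 0)) * (real k + 1)" for k
    using E0 by (simp add: algebra_simps)
  ultimately show ?thesis using that order_trans by blast
qed

text \<open>With \<open>q = d - 1\<close>, scaling by \<open>sqrt q ^ k\<close> normalises the
  recurrence to the form above. The square of the scaled value carries \<open>q ^ k\<close>, the
  sphere only \<open>d * q ^ (k - 1)\<close> vertices, and the spare factor \<open>q \<ge> 1\<close>
  is discarded.\<close>

lemma spherical_mass_bound:
  assumes d: "d \<ge> 2" and \<theta>: "\<bar>\<theta>\<bar> \<le> 2 * sqrt (real d - 1)"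
  obtains C where "\<And>k. spherical_mass d \<theta> k \<le> C * (real k + 1)\<^sup>2"
proof -
  define q where "q = real d - 1"
  have q: "q \<ge> 1" using d by (simp add: q_def)
  define s where "s = sqrt q"
  have s: "s > 0" "s\<^sup>2 = q" using q by (auto simp: s_def)
  define b where "b k = s ^ k * spherical d \<theta> k" for k
  have rec: "b (Suc (Suc k)) = \<theta> / s * b (Suc k) - b k" for k
  proof -
    have "b (Suc (Suc k)) = s ^ k * (s\<^sup>2 * spherical d \<theta> (Suc (Suc k)))"
      by (simp add: b_def power2_eq_square)
    also have "s\<^sup>2 * spherical d \<theta> (Suc (Suc k)) = \<theta> * spherical d \<theta> (Suc k) - spherical d \<theta> k"
      using q s by (simp add: q_def)
    finally show ?thesis using s by (simp add: b_def algebra_simps)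
  qed
  have "\<bar>\<theta> / s\<bar> \<le> 2" using \<theta> s by (simp add: s_def q_def field_simps)
  from linear_recurrence_bound[of b, OF rec this]
  obtain C where C: "\<And>k. \<bar>b k\<bar> \<le> C * (real k + 1)" by blast
  have b2: "(b k)\<^sup>2 \<le> C\<^sup>2 * (real k + 1)\<^sup>2" for k
    using power_mono[OF C[of k], of 2] by (simp add: power_mult_distrib)
  have "spherical_mass d \<theta> k \<le> real d * (C\<^sup>2 * (real k + 1)\<^sup>2)" for k
  proof (cases k)
    case 0
    have "1 * 1 \<le> real d * C\<^sup>2" using b2[of 0] d by (intro mult_mono) (auto simp: b_def)
    then show ?thesis using 0 by (simp add: spherical_mass_def)
  next
    case (Suc j)
    have "(s ^ k)\<^sup>2 = q * q ^ j"
      unfolding Suc s(2)[symmetric] by (simp add: power2_eq_square power_mult_distrib)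
    then have "(b k)\<^sup>2 = q * q ^ j * (spherical d \<theta> k)\<^sup>2"
      by (simp add: b_def power_mult_distrib)
    moreover have "1 * (q ^ j * (spherical d \<theta> k)\<^sup>2) \<le> q * (q ^ j * (spherical d \<theta> k)\<^sup>2)"
      using q by (intro mult_right_mono) auto
    ultimately have "q ^ j * (spherical d \<theta> k)\<^sup>2 \<le> C\<^sup>2 * (real k + 1)\<^sup>2" using b2[of k] by (simp add: mult.assoc)
    then have "real d * (q ^ j * (spherical d \<theta> k)\<^sup>2) \<le> real d * (C\<^sup>2 * (real k + 1)\<^sup>2)"
      by (intro mult_left_mono) auto
    then show ?thesis using Suc by (simp add: spherical_mass_def q_def mult.assoc)
  qed
  then show ?thesis using that[of "real d * C\<^sup>2"] by (simp add: mult.assoc)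
qed

text \<open>Otherwise the partial sums would grow by a factor \<open>1 + e\<close> with every two
  terms, against their cubic upper bound.\<close>

lemma subexponential_boundary:
  fixes a :: "nat \<Rightarrow> real"
  assumes a0: "a 0 > 0" and a: "\<And>k. a k \<ge> 0" and bound: "\<And>k. a k \<le> C * (real k + 1)\<^sup>2" and e: "e > 0"
  shows "\<exists>m\<ge>1. a m + a (Suc m) \<le> e * (\<Sum>j\<le>m. a j)"
proof (rule ccontr)
  assume contr: "\<not> ?thesis"
  have big: "a m + a (Suc m) > e * (\<Sum>j\<le>m. a j)" if "m \<ge> 1" for m
    using contr that not_le by blast
  define S where "S m = (\<Sum>j\<le>m. a j)" for m
  have "(1 + e) ^ n * a 0 \<le> S (2 * n)" for n
  proof (induction n)
    case (Suc n)
    have "(1 + e) ^ Suc n * a 0 \<le> (1 + e) * S (2 * n)"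
      using Suc mult_left_mono[of _ "S (2 * n)" "1 + e"] e by (simp add: mult.assoc)
    also have "\<dots> \<le> S (2 * n) + e * S (Suc (2 * n))"
      using e a[of "Suc (2 * n)"] by (simp add: S_def algebra_simps)
    \<comment> \<open>The negated claim is used at \<open>m = 2 * n + 1\<close>; its two boundary
      terms are exactly those that lead from \<open>S (2 * n)\<close> to
      \<open>S (2 * Suc n)\<close>.\<close>
    also have "\<dots> \<le> S (2 * n) + (a (Suc (2 * n)) + a (Suc (Suc (2 * n))))"
      using big[of "Suc (2 * n)"] by (simp add: S_def)
    finally show ?case by (simp add: S_def)
  qed (simp add: S_def)
  moreover have "S (2 * n) \<le> C * (2 * real n + 1) ^ 3" for n
  proof -
    have C: "C \<ge> 0" using bound[of 0] a[of 0] by simp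
    have "S (2 * n) \<le> (\<Sum>j\<le>2 * n. C * (2 * real n + 1)\<^sup>2)"
      unfolding S_def
    proof (rule sum_mono)
      fix j assume "j \<in> {..2 * n}"
      then have "real j \<le> 2 * real n" by simp
      then have "C * (real j + 1)\<^sup>2 \<le> C * (2 * real n + 1)\<^sup>2"
        using C by (intro mult_left_mono power_mono) auto
      then show "a j \<le> C * (2 * real n + 1)\<^sup>2" using bound[of j] by linarith
    qed
    also have "\<dots> = C * (2 * real n + 1) ^ 3" by (simp add: power2_eq_square power3_eq_cube)
    finally show ?thesis .
  qed
  ultimately have "(1 + e) ^ n * a 0 \<le> C * (2 * real n + 1) ^ 3" for n
    using order_trans by blast
  then have le: "a 0 \<le> C * ((2 * real n + 1) ^ 3 / (1 + e) ^ n)" for n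
    using e by (simp add: field_simps)
  have "(\<lambda>n. (2 * real n + 1) ^ 3 / (1 + e) ^ n) \<longlonglongrightarrow> 0"
    using e by real_asymp
  then have "(\<lambda>n. C * ((2 * real n + 1) ^ 3 / (1 + e) ^ n)) \<longlonglongrightarrow> C * 0"
    by (rule tendsto_mult_left)
  then have "a 0 \<le> C * 0" by (rule LIMSEQ_le_const) (use le in blast)
  then show False using a0 by simp
qed

text \<open>The value at \<open>k + 2\<close> can be solved for, as \<open>d - 1\<close> is nonzero,
  so limits propagate along the recurrence from the exact value 1. The errors need to vanish only
  for each fixed \<open>k\<close>.\<close>

lemma spherical_limit:
  assumes d: "d \<ge> 2"
    and 0: "\<And>n. \<kappa> n 0 = 1"
    and 1: "(\<lambda>n. real d * \<kappa> n 1 - \<theta> * \<kappa> n 0) \<longlonglongrightarrow> 0"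
    and 2: "\<And>k. (\<lambda>n. \<kappa> n k + (real d - 1) * \<kappa> n (Suc (Suc k)) - \<theta> * \<kappa> n (Suc k)) \<longlonglongrightarrow> 0"
  shows "(\<lambda>n. \<kappa> n k) \<longlonglongrightarrow> spherical d \<theta> k"
proof (induction k rule: spherical.induct[where ?a0.0 = d and ?a1.0 = \<theta> and P = "\<lambda>_ _ k. (\<lambda>n. \<kappa> n k) \<longlonglongrightarrow> spherical d \<theta> k"])
  case (1 d' \<theta>')
  then show ?case by (simp add: 0)
next
  case (2 d' \<theta>')
  have "(\<lambda>n. (real d * \<kappa> n 1 - \<theta> * \<kappa> n 0 + \<theta>) / real d) \<longlonglongrightarrow> (0 + \<theta>) / real d"
    by (intro tendsto_intros assms(3)) (use d in auto)
  then show ?case using d by (simp add: 0)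
next
  case (3 d' \<theta>' k)
  have "(\<lambda>n. ((\<kappa> n k + (real d - 1) * \<kappa> n (Suc (Suc k)) - \<theta> * \<kappa> n (Suc k)) + \<theta> * \<kappa> n (Suc k) - \<kappa> n k) / (real d - 1))
     \<longlonglongrightarrow> (0 + \<theta> * spherical d \<theta> (Suc k) - spherical d \<theta> k) / (real d - 1)"
    by (intro tendsto_intros 3 assms(4)) (use d in auto)
  then show ?case using d by simp
qed

section \<open>Regular trees\<close>

text \<open>This steers an automorphism along a prescribed path.\<close>

lemma ex_bij_betw_point:
  assumes "finite A" "finite B" "card A = card B" "a \<in> A" "b \<in> B"
  shows "\<exists>h. bij_betw h A B \<and> h a = b"
proof -
  have "card (A - {a}) = card (B - {b})" using assms by simp
  then obtain h where "bij_betw h (A - {a}) (B - {b})"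
    using assms finite_same_card_bij[of "A - {a}" "B - {b}"] by auto
  then have "bij_betw (h(a := b)) (A - {a} \<union> {a}) (B - {b} \<union> {b})"
    by (intro bij_betw_combine) (auto simp: bij_betw_def inj_on_def)
  then show ?thesis using assms by (intro exI[of _ "h(a := b)"]) (auto simp: insert_absorb)
qed

locale regular_tree_graph =
  fixes d :: nat and adj :: "'v \<Rightarrow> 'v \<Rightarrow> bool"
  assumes tree: "regular_tree d adj" and d_pos: "d > 0"
begin

lemma adj_sym: "adj u v \<longleftrightarrow> adj v u"
  using tree by (auto simp: regular_tree_def symp_def)

lemma adj_irrefl: "\<not> adj u u"
  using tree by (auto simp: regular_tree_def irreflp_def)

lemma connected: "adj\<^sup>*\<^sup>* u v"
  using tree by (auto simp: regular_tree_def)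

lemma finite_nbrs [simp]: "finite {u. adj v u}" and card_nbrs: "card {u. adj v u} = d"
  using tree by (auto simp: regular_tree_def)

lemma no_cycle: "\<not> graph_cycle adj xs"
  using tree by (auto simp: regular_tree_def)

section \<open>Non-backtracking walks as geodesics\<close>

abbreviation gdist :: "'v \<Rightarrow> 'v \<Rightarrow> nat" where
  "gdist \<equiv> graph_dist adj"

text \<open>Non-backtracking is a condition on three consecutive vertices, so gluing and reversing
  are local checks, unlike for distinctness; in a tree it nevertheless implies distinctness.\<close>

fun nb_walk :: "'v list \<Rightarrow> bool" where
  "nb_walk [] \<longleftrightarrow> True"
| "nb_walk [x] \<longleftrightarrow> True"
| "nb_walk [x, y] \<longleftrightarrow> adj x y"
| "nb_walk (x # y # z # xs) \<longleftrightarrow> adj x y \<and> x \<noteq> z \<and> nb_walk (y # z # xs)"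

lemma nb_walk_tl: "nb_walk (x # xs) \<Longrightarrow> nb_walk xs"
  by (cases xs rule: nb_walk.cases) auto

lemma nb_walk_append2: "nb_walk (xs @ ys) \<Longrightarrow> nb_walk ys"
  by (induction xs) (auto dest: nb_walk_tl)

lemma nb_walk_append1: "nb_walk (xs @ ys) \<Longrightarrow> nb_walk xs"
  by (induction xs rule: nb_walk.induct) (auto dest: nb_walk_tl simp: neq_Nil_conv elim: nb_walk.elims)

lemma nb_walk_successively: "nb_walk xs \<Longrightarrow> successively adj xs"
  by (induction xs rule: nb_walk.induct) auto

lemma nb_walk_join:
  assumes "nb_walk (as @ [t])" "nb_walk (t # cs)" "as \<noteq> [] \<Longrightarrow> cs \<noteq> [] \<Longrightarrow> last as \<noteq> hd cs"
  shows "nb_walk (as @ t # cs)"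
  using assms
proof (induction as rule: nb_walk.induct)
  case (2 x)
  then show ?case by (cases cs) auto
next
  case (3 x y)
  then show ?case by (cases cs) auto
qed auto

lemma nb_walk_rev: "nb_walk xs \<Longrightarrow> nb_walk (rev xs)"
proof (induction xs rule: nb_walk.induct)
  case (4 x y z xs)
  then show ?case
    using nb_walk_join[of "rev xs @ [z]" y "[x]"] by (auto simp: adj_sym[of y x])
qed (auto simp: adj_sym)

text \<open>This is where acyclicity enters. The tail is distinct by induction, so a return to the
  head closes a cycle; irreflexivity and non-backtracking exclude returns after one and two steps,
  which leaves at least three vertices.\<close>

lemma nb_walk_distinct: "nb_walk xs \<Longrightarrow> distinct xs"
proof (induction xs)
  case (Cons x xs)
  have "x \<notin> set xs"
  proof
    assume "x \<in> set xs"
    then obtain as bs where xs: "xs = as @ x # bs" by (auto simp: in_set_conv_decomp)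
    have w: "nb_walk (x # as @ [x])"
      using Cons.prems nb_walk_append1[of "x # as @ [x]" bs] by (simp add: xs)
    have "successively adj (x # as @ [x])" using nb_walk_successively[OF w] .
    moreover have ne: "as \<noteq> []" using w adj_irrefl by auto
    ultimately have "successively adj (x # as)" "adj (last as) x"
      by (auto simp: successively_append_iff successively_Cons)
    moreover have "length as \<noteq> 1" using w by (auto simp: length_Suc_conv)
    moreover have "distinct (x # as)"
      using Cons.IH[OF nb_walk_tl[OF Cons.prems]] by (simp add: xs)
    ultimately have "graph_cycle adj (x # as)"
      using ne by (cases as) (auto simp: graph_cycle_def neq_Nil_conv Suc_le_eq)
    then show False using no_cycle by blast
  qed
  then show ?case using Cons.IH[OF nb_walk_tl[OF Cons.prems]] by simp
qed simp

text \<open>The starting point \<open>u\<close> is stored last, so that extending a walk is a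
  \<open>Cons\<close> and the parent of its endpoint is the head of \<open>tl\<close>.\<close>

definition walks :: "'v \<Rightarrow> 'v list set" where
  "walks u = {xs. xs \<noteq> [] \<and> nb_walk xs \<and> last xs = u}"

lemma walks_singleton [simp]: "[u] \<in> walks u"
  by (simp add: walks_def)

lemma walks_Cons:
  "y # x # xs \<in> walks u \<longleftrightarrow> x # xs \<in> walks u \<and> adj x y \<and> (xs \<noteq> [] \<longrightarrow> y \<noteq> hd xs)"
  by (cases xs) (auto simp: walks_def adj_sym)

text \<open>Strip the longest common suffix down to the branching vertex \<open>c\<close>. The rest
  of one walk, \<open>c\<close>, and the reversed rest of the other form a non-backtracking walk,
  hence distinct vertices, although both walks have the same endpoint.\<close>

lemma walks_hd_inj:
  assumes xs: "xs \<in> walks u" and ys: "ys \<in> walks u" and "hd xs = hd ys"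
  shows "xs = ys"
proof (rule ccontr)
  assume "xs \<noteq> ys"
  obtain t as bs where as: "xs = as @ t" and bs: "ys = bs @ t"
    and max: "as = [] \<or> bs = [] \<or> last as \<noteq> last bs"
    using longest_common_suffix[of xs ys] by blast
  have "t \<noteq> []"
  proof
    assume "t = []"
    then show False using max as bs xs ys by (auto simp: walks_def)
  qed
  then obtain c t' where t: "t = c # t'" by (cases t) auto
  have 1: "nb_walk (as @ [c])" using xs nb_walk_append1[of "as @ [c]" t'] by (simp add: walks_def as t)
  have "nb_walk (bs @ [c])" using ys nb_walk_append1[of "bs @ [c]" t'] by (simp add: walks_def bs t)
  then have 2: "nb_walk (c # rev bs)" using nb_walk_rev by force
  have "nb_walk (as @ c # rev bs)"
    using max by (intro nb_walk_join[OF 1 2]) (auto simp: hd_rev)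
  then have dist: "distinct (as @ c # rev bs)" by (rule nb_walk_distinct)
  show False
    using dist \<open>hd xs = hd ys\<close> \<open>xs \<noteq> ys\<close>
    by (cases as; cases bs) (auto simp: as bs t)
qed

lemma walks_step:
  assumes "xs \<in> walks u" "adj (hd xs) z"
  shows "(tl xs \<in> walks u \<and> hd (tl xs) = z \<and> tl xs \<noteq> []) \<or> z # xs \<in> walks u"
proof (cases xs)
  case (Cons x ys)
  then show ?thesis
    using assms by (cases ys) (auto simp: walks_Cons)
qed (use assms in \<open>auto simp: walks_def\<close>)

text \<open>Follow any path from \<open>u\<close>: each edge either extends the current walk or
  retracts its last step.\<close>

lemma walks_hd_surj: "\<exists>xs\<in>walks u. hd xs = v"
  using connected[of u v]
proof induction
  case base
  show ?case by (rule bexI[of _ "[u]"]) auto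
next
  case (step y z)
  then show ?case using walks_step by (metis list.sel(1))
qed

lemma walks_adj:
  assumes "xs \<in> walks u" "ys \<in> walks u" "adj (hd xs) (hd ys)"
  shows "ys = hd ys # xs \<or> xs = hd xs # ys"
  using walks_step[OF assms(1,3)]
proof
  assume "tl xs \<in> walks u \<and> hd (tl xs) = hd ys \<and> tl xs \<noteq> []"
  then have "tl xs = ys" using walks_hd_inj assms(2) by blast
  then show ?thesis using assms(1) by (cases xs) (auto simp: walks_def)
next
  assume "hd ys # xs \<in> walks u"
  then have "hd ys # xs = ys" using assms(2) by (intro walks_hd_inj) auto
  then show ?thesis by simp
qed

text \<open>The list counts vertices, hence the \<open>- 1\<close>. The walk itself bounds the
  distance from above; conversely, one edge lengthens the unique walk to the current vertex by at
  most one.\<close>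

lemma gdist_walks:
  assumes "xs \<in> walks u"
  shows "gdist u (hd xs) = length xs - 1"
proof -
  have lower: "\<forall>ys\<in>walks u. hd ys = y \<longrightarrow> length ys \<le> Suc n" if "(adj ^^ n) u y" for n y
    using that
  proof (induction n arbitrary: y)
    case 0
    then have "y = u" by simp
    have "length ys \<le> Suc 0" if "ys \<in> walks u" "hd ys = u" for ys
    proof -
      have "ys = [u]" using walks_hd_inj[OF that(1) walks_singleton] that(2) by simp
      then show ?thesis by simp
    qed
    then show ?case using \<open>y = u\<close> by blast
  next
    case (Suc n)
    then obtain z where z: "(adj ^^ n) u z" "adj z y" by auto
    obtain zs where zs: "zs \<in> walks u" "hd zs = z" using walks_hd_surj by blast
    have "length zs \<le> Suc n" using Suc.IH[OF z(1)] zs by blast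
    show ?case
    proof (intro ballI impI)
      fix ys assume ys: "ys \<in> walks u" "hd ys = y"
      have "ys = y # zs \<or> zs = z # ys"
        using walks_adj[OF zs(1) ys(1)] zs(2) ys(2) z(2) by simp
      then show "length ys \<le> Suc (Suc n)" using \<open>length zs \<le> Suc n\<close> by auto
    qed
  qed
  have "(adj ^^ (length xs - 1)) u (hd xs)"
    using assms
  proof (induction xs)
    case (Cons x xs)
    show ?case
    proof (cases xs)
      case Nil
      then show ?thesis using Cons.prems by (auto simp: walks_def)
    next
      case (Cons y ys)
      then show ?thesis using Cons.prems Cons.IH by (auto simp: walks_Cons)
    qed
  qed (simp add: walks_def)
  then show ?thesis unfolding graph_dist_def
    by (rule Least_equality) (use lower assms in fastforce)
qed

section \<open>Distances, neighbours and spheres\<close>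

lemma gdist_commute: "gdist u v = gdist v u"
proof -
  have "(adj ^^ n) u v \<Longrightarrow> (adj ^^ n) v u" for n u v
  proof (induction n arbitrary: u v)
    case (Suc n)
    then obtain w where "(adj ^^ n) u w" "adj w v" by auto
    then show ?case using Suc.IH adj_sym relpowp_Suc_I2 by metis
  qed auto
  then show ?thesis unfolding graph_dist_def by metis
qed

lemma gdist_self [simp]: "gdist u u = 0"
  using gdist_walks[of "[u]" u] by simp

lemma gdist_eq_0_iff: "gdist u v = 0 \<longleftrightarrow> u = v"
proof
  assume 0: "gdist u v = 0"
  obtain xs where xs: "xs \<in> walks u" "hd xs = v" using walks_hd_surj by blast
  then have "length xs = 1" using gdist_walks[OF xs(1)] 0 by (cases xs) (auto simp: walks_def)
  then show "u = v" using xs by (auto simp: walks_def length_Suc_conv)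
qed simp

text \<open>Seen from \<open>u\<close>, a vertex \<open>x \<noteq> u\<close> has one neighbour
  nearer by one, its parent, and \<open>d - 1\<close> farther by one. This is the adjacency operator
  on radial functions, the origin of the recurrence for \<open>spherical\<close>.\<close>

lemma sum_nbrs:
  fixes \<kappa> :: "nat \<Rightarrow> real"
  shows "(\<Sum>y | adj x y. \<kappa> (gdist u y)) =
    (if x = u then real d * \<kappa> 1
     else \<kappa> (gdist u x - 1) + (real d - 1) * \<kappa> (Suc (gdist u x)))"
proof -
  obtain xs where xs: "xs \<in> walks u" "hd xs = x" using walks_hd_surj by blast
  obtain ts where ts: "xs = x # ts" using xs by (cases xs) (auto simp: walks_def)
  have up: "gdist u y = length xs" if "adj x y" "ts = [] \<or> y \<noteq> hd ts" for y
  proof -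
    have "y # xs \<in> walks u" using that xs by (auto simp: ts walks_Cons)
    from gdist_walks[OF this] show ?thesis by simp
  qed
  have x: "gdist u x = length xs - 1" using gdist_walks[OF xs(1)] xs(2) by simp
  show ?thesis
  proof (cases ts)
    case Nil
    then have "x = u" using xs ts by (auto simp: walks_def)
    moreover have "(\<Sum>y | adj x y. \<kappa> (gdist u y)) = (\<Sum>y | adj x y. \<kappa> 1)"
      using Nil up by (intro sum.cong) (auto simp: ts)
    ultimately show ?thesis by (simp add: card_nbrs)
  next
    case (Cons p ps)
    have p: "adj x p" "p # ps \<in> walks u" using xs by (auto simp: ts Cons walks_Cons adj_sym)
    have ne: "x \<noteq> u" using x ts Cons gdist_self by auto
    have dp: "gdist u p = gdist u x - 1" using gdist_walks[OF p(2)] x by (simp add: ts Cons)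
    have "(\<Sum>y | adj x y. \<kappa> (gdist u y)) = \<kappa> (gdist u p) + (\<Sum>y \<in> {y. adj x y} - {p}. \<kappa> (gdist u y))"
      using p by (intro sum.remove) auto
    also have "(\<Sum>y \<in> {y. adj x y} - {p}. \<kappa> (gdist u y)) = (\<Sum>y \<in> {y. adj x y} - {p}. \<kappa> (Suc (gdist u x)))"
      using up by (intro sum.cong) (auto simp: ts Cons x)
    also have "\<dots> = (real d - 1) * \<kappa> (Suc (gdist u x))"
      using p d_pos by (simp add: card_Diff_singleton card_nbrs of_nat_diff Suc_leI)
    finally show ?thesis using ne dp by simp
  qed
qed

abbreviation gsphere :: "'v \<Rightarrow> nat \<Rightarrow> 'v set" where
  "gsphere u k \<equiv> {v. gdist u v = k}"

lemma gsphere_Suc_pred: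
  assumes "gdist u y = Suc k"
  shows "\<exists>x. adj x y \<and> gdist u x = k"
proof -
  obtain ys where ys: "ys \<in> walks u" "hd ys = y" using walks_hd_surj by blast
  have "length ys = Suc (Suc k)" using gdist_walks[OF ys(1)] ys assms by simp
  then obtain x zs where z: "ys = y # x # zs" "length zs = k" using ys by (auto simp: length_Suc_conv)
  then have "x # zs \<in> walks u" "adj x y" using ys by (auto simp: walks_Cons)
  then show ?thesis using gdist_walks[of "x # zs" u] z by auto
qed

lemma finite_gsphere [simp]: "finite (gsphere u k)"
proof (induction k)
  case 0
  then show ?case by (simp add: gdist_eq_0_iff)
next
  case (Suc k)
  have "gsphere u (Suc k) \<subseteq> (\<Union>x\<in>gsphere u k. {y. adj x y})"
    using gsphere_Suc_pred by blast
  then show ?case by (rule finite_subset) (use Suc in auto)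
qed

text \<open>Double counting of the edges between consecutive spheres, with \<open>sum_nbrs\<close>
  applied to indicator functions on either side.\<close>

lemma card_gsphere_Suc:
  "real (card (gsphere u (Suc k))) = (if k = 0 then real d else (real d - 1) * real (card (gsphere u k)))"
proof -
  have *: "(\<Sum>y\<in>gsphere u j. if adj x y then 1 else 0) = (\<Sum>y | adj x y. (if gdist u y = j then 1 else 0 :: real))" for j x
    by (simp add: sum.If_cases Int_commute Collect_conj_eq[symmetric])
  have "real (card (gsphere u (Suc k))) = (\<Sum>y\<in>gsphere u (Suc k). \<Sum>x\<in>gsphere u k. if adj y x then 1 else 0)"
  proof -
    have "(\<Sum>x\<in>gsphere u k. if adj y x then 1 else 0 :: real) = 1" if "y \<in> gsphere u (Suc k)" for y
      unfolding * sum_nbrs[of "\<lambda>i. if i = k then 1 else 0"] using that by auto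
    then show ?thesis by simp
  qed
  also have "\<dots> = (\<Sum>x\<in>gsphere u k. \<Sum>y\<in>gsphere u (Suc k). if adj x y then 1 else 0)"
    by (subst sum.swap) (simp add: adj_sym)
  also have "\<dots> = (\<Sum>x\<in>gsphere u k. if k = 0 then real d else (real d - 1))"
    unfolding * sum_nbrs[of "\<lambda>i. if i = Suc k then 1 else 0"]
    by (intro sum.cong) (auto simp: gdist_eq_0_iff simp flip: neq0_conv)
  finally show ?thesis by (auto simp: gdist_eq_0_iff)
qed

lemma card_gsphere_0: "card (gsphere u 0) = 1"
  by (simp add: gdist_eq_0_iff)

section \<open>Construction of automorphisms\<close>

definition children :: "'v list \<Rightarrow> 'v set" where
  "children xs = {y. adj (hd xs) y \<and> (tl xs \<noteq> [] \<longrightarrow> y \<noteq> hd (tl xs))}"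

lemma finite_children [simp]: "finite (children xs)"
  by (rule finite_subset[OF _ finite_nbrs[of "hd xs"]]) (auto simp: children_def)

lemma walks_Cons_children: "xs \<noteq> [] \<Longrightarrow> y # xs \<in> walks u \<longleftrightarrow> xs \<in> walks u \<and> y \<in> children xs"
  by (cases xs) (auto simp: walks_Cons children_def)

lemma card_children:
  assumes "xs \<in> walks u"
  shows "card (children xs) = (if length xs = 1 then d else d - 1)"
proof -
  obtain x ts where xs: "xs = x # ts" using assms by (cases xs) (auto simp: walks_def)
  show ?thesis
  proof (cases ts)
    case Nil
    then show ?thesis by (simp add: children_def xs card_nbrs)
  next
    case (Cons p ps)
    have "adj x p" using assms by (auto simp: xs Cons walks_Cons adj_sym)
    moreover have "children xs = {y. adj x y} - {p}" by (auto simp: children_def xs Cons)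
    ultimately show ?thesis by (simp add: xs Cons card_nbrs)
  qed
qed

text \<open>A tree rooted at \<open>u\<close> is the tree of non-backtracking walks from \<open>u\<close>, so an automorphism
  can be built recursively by choosing bijections between the children of corresponding walks;
  along a prescribed path the choice is forced.\<close>

lemma two_point_homogeneous:
  assumes eq: "gdist u v = gdist u' v'"
  obtains \<phi> where "graph_automorphism adj \<phi>" "\<phi> u = u'" "\<phi> v = v'"
proof -
  obtain xs0 where xs0: "xs0 \<in> walks u" "hd xs0 = v" using walks_hd_surj by blast
  obtain zs0 where zs0: "zs0 \<in> walks u'" "hd zs0 = v'" using walks_hd_surj by blast
  have len0: "length xs0 = length zs0"
    using gdist_walks[OF xs0(1)] gdist_walks[OF zs0(1)] eq xs0 zs0
    by (cases xs0; cases zs0) (auto simp: walks_def)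
  have suff_eq: "y = y'" if "suffix (y # xs) ws" "suffix (y' # xs) ws" for y y' xs and ws :: "'v list"
    using that by (auto simp: suffix_def)
  \<comment> \<open>By \<open>suff_eq\<close> at most one child continues each prescribed path, so
    the last clause imposes at most one value on \<open>h\<close>.\<close>
  have "\<exists>h. bij_betw h (children xs) (children zs) \<and>
     (\<forall>y y'. y \<in> children xs \<longrightarrow> y' \<in> children zs \<longrightarrow> suffix (y # xs) xs0 \<longrightarrow> suffix (y' # zs) zs0 \<longrightarrow> h y = y')"
    if card: "card (children xs) = card (children zs)" for xs zs
  proof (cases "\<exists>y y'. y \<in> children xs \<and> y' \<in> children zs \<and> suffix (y # xs) xs0 \<and> suffix (y' # zs) zs0")
    case True
    then obtain y y' where y: "y \<in> children xs" "y' \<in> children zs" "suffix (y # xs) xs0" "suffix (y' # zs) zs0"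
      by blast
    obtain h where "bij_betw h (children xs) (children zs)" "h y = y'"
      using ex_bij_betw_point[OF _ _ card y(1,2)] by auto
    then show ?thesis using suff_eq y by blast
  next
    case False
    then show ?thesis using finite_same_card_bij[OF _ _ that] by auto
  qed
  then obtain h where h: "\<And>xs zs. card (children xs) = card (children zs) \<Longrightarrow> bij_betw (h xs zs) (children xs) (children zs)"
    "\<And>xs zs y y'. card (children xs) = card (children zs) \<Longrightarrow> y \<in> children xs \<Longrightarrow> y' \<in> children zs \<Longrightarrow>
       suffix (y # xs) xs0 \<Longrightarrow> suffix (y' # zs) zs0 \<Longrightarrow> h xs zs y = y'"
    by metis
  \<comment> \<open>The root goes to \<open>u'\<close>, and each extension follows the bijection
    between the children of a walk and those of its image. On \<open>walks u\<close> the numbers of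
    children agree because \<open>\<Phi>\<close> preserves length.\<close>
  define \<Phi> where "\<Phi> = rec_list [] (\<lambda>y xs zs. if xs = [] then [u'] else h xs zs y # zs)"
  have \<Phi>_simps: "\<Phi> [] = []" "\<Phi> (y # xs) = (if xs = [] then [u'] else h xs (\<Phi> xs) y # \<Phi> xs)" for y xs
    by (simp_all add: \<Phi>_def)
  have \<Phi>_len: "length (\<Phi> xs) = length xs" for xs
    by (induction xs) (auto simp: \<Phi>_simps)
  have \<Phi>_walk: "\<Phi> xs \<in> walks u'" if "xs \<in> walks u" for xs
    using that
  proof (induction xs)
    case (Cons y xs)
    show ?case
    proof (cases "xs = []")
      case False
      then have xs: "xs \<in> walks u" "y \<in> children xs" using Cons.prems by (auto simp: walks_Cons_children)
      have "\<Phi> xs \<in> walks u'" using Cons.IH xs by blast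
      moreover have "card (children xs) = card (children (\<Phi> xs))"
        using card_children[OF xs(1)] card_children[OF \<open>\<Phi> xs \<in> walks u'\<close>] by (simp add: \<Phi>_len)
      ultimately have "h xs (\<Phi> xs) y \<in> children (\<Phi> xs)"
        using xs(2) h(1)[of xs "\<Phi> xs"] by (auto simp: bij_betw_def)
      moreover have "\<Phi> xs \<noteq> []" using False \<Phi>_len[of xs] by auto
      ultimately show ?thesis
        using False \<open>\<Phi> xs \<in> walks u'\<close> by (simp add: \<Phi>_simps walks_Cons_children)
    qed (auto simp: \<Phi>_simps)
  qed (simp add: walks_def)
  have cards: "card (children xs) = card (children (\<Phi> xs))" if "xs \<in> walks u" for xs
    using card_children[OF that] card_children[OF \<Phi>_walk[OF that]] by (simp add: \<Phi>_len)
  have bij_h: "bij_betw (h xs (\<Phi> xs)) (children xs) (children (\<Phi> xs))" if "xs \<in> walks u" for xs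
    by (rule h(1)[OF cards[OF that]])
  have \<Phi>_inj: "xs = ys" if "xs \<in> walks u" "ys \<in> walks u" "\<Phi> xs = \<Phi> ys" for xs ys
    using that
  proof (induction xs arbitrary: ys)
    case (Cons x xs)
    obtain y ys' where ys: "ys = y # ys'" using Cons.prems by (cases ys) (auto simp: walks_def)
    have "length xs = length ys'" using Cons.prems(3) \<Phi>_len[of "x # xs"] \<Phi>_len[of ys] ys by simp
    show ?case
    proof (cases "xs = []")
      case True
      then show ?thesis using \<open>length xs = length ys'\<close> Cons.prems ys by (auto simp: walks_def)
    next
      case False
      then have ne: "ys' \<noteq> []" using \<open>length xs = length ys'\<close> by auto
      have w: "xs \<in> walks u" "x \<in> children xs" "ys' \<in> walks u" "y \<in> children ys'"
        using Cons.prems False ne by (auto simp: walks_Cons_children ys)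
      have "\<Phi> xs = \<Phi> ys'" "h xs (\<Phi> xs) x = h ys' (\<Phi> ys') y"
        using Cons.prems(3) False ne by (auto simp: \<Phi>_simps ys)
      then have "xs = ys'" using Cons.IH w by blast
      then show ?thesis
        using bij_h[OF w(1)] w \<open>h xs (\<Phi> xs) x = h ys' (\<Phi> ys') y\<close> by (auto simp: ys bij_betw_def inj_on_def)
    qed
  qed (simp add: walks_def)
  have \<Phi>_surj: "\<exists>xs\<in>walks u. \<Phi> xs = zs" if "zs \<in> walks u'" for zs
    using that
  proof (induction zs)
    case (Cons z zs)
    show ?case
    proof (cases "zs = []")
      case True
      then show ?thesis using Cons.prems by (intro bexI[of _ "[u]"]) (auto simp: \<Phi>_simps walks_def)
    next
      case False
      then have zs: "zs \<in> walks u'" "z \<in> children zs" using Cons.prems by (auto simp: walks_Cons_children)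
      then obtain xs where xs: "xs \<in> walks u" "\<Phi> xs = zs" using Cons.IH by blast
      have "xs \<noteq> []" using xs by (auto simp: walks_def)
      have "z \<in> h xs zs ` children xs"
        using bij_h[OF xs(1)] zs(2) xs(2) by (simp add: bij_betw_def)
      then obtain y where "y \<in> children xs" "h xs zs y = z" by blast
      then show ?thesis using xs \<open>xs \<noteq> []\<close>
        by (intro bexI[of _ "y # xs"]) (auto simp: \<Phi>_simps walks_Cons_children)
    qed
  qed (simp add: walks_def)
  have \<Phi>_suffix: "\<Phi> xs = zs" if "suffix xs xs0" "suffix zs zs0" "length xs = length zs" for xs zs
    using that
  proof (induction xs arbitrary: zs)
    case (Cons x xs)
    obtain z zs' where zs: "zs = z # zs'" using Cons.prems by (cases zs) auto
    have w: "x # xs \<in> walks u" "z # zs' \<in> walks u'"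
      using Cons.prems xs0 zs0 by (auto simp: walks_def suffix_def zs dest: nb_walk_append2)
    show ?case
    proof (cases "xs = []")
      case True
      then show ?thesis using Cons.prems(3) w by (auto simp: zs \<Phi>_simps walks_def)
    next
      case False
      then have ne: "zs' \<noteq> []" using Cons.prems(3) zs by auto
      have w': "xs \<in> walks u" "x \<in> children xs" "zs' \<in> walks u'" "z \<in> children zs'"
        using w False ne by (auto simp: walks_Cons_children)
      have "\<Phi> xs = zs'" using Cons.prems zs by (intro Cons.IH) (auto dest: suffix_ConsD)
      then show ?thesis
        using h(2)[of xs zs' x z] cards[OF w'(1)] w' Cons.prems False by (auto simp: zs \<Phi>_simps)
    qed
  qed (simp add: \<Phi>_simps)
  \<comment> \<open>\<open>W\<close> inverts \<open>hd\<close> on walks and turns the bijection of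
    walks into one of vertices.\<close>
  define W where "W x = (THE xs. xs \<in> walks u \<and> hd xs = x)" for x
  have W: "W x \<in> walks u" "hd (W x) = x" for x
  proof -
    have "\<exists>!xs. xs \<in> walks u \<and> hd xs = x" using walks_hd_surj walks_hd_inj by metis
    from theI'[OF this] show "W x \<in> walks u" "hd (W x) = x" unfolding W_def by auto
  qed
  have W_eq: "W (hd xs) = xs" if "xs \<in> walks u" for xs
    using walks_hd_inj W that by blast
  define \<phi> where "\<phi> x = hd (\<Phi> (W x))" for x
  have inj: "x = y" if "\<phi> x = \<phi> y" for x y
  proof -
    have "\<Phi> (W x) = \<Phi> (W y)"
      using that by (intro walks_hd_inj[OF \<Phi>_walk[OF W(1)] \<Phi>_walk[OF W(1)]]) (auto simp: \<phi>_def)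
    then show ?thesis using \<Phi>_inj W by metis
  qed
  have surj: "\<exists>x. \<phi> x = z" for z
  proof -
    obtain zs where zs: "zs \<in> walks u'" "hd zs = z" using walks_hd_surj by blast
    then show ?thesis using \<Phi>_surj W_eq unfolding \<phi>_def by metis
  qed
  have \<Phi>_W: "\<Phi> (W x) \<in> walks u'" "hd (\<Phi> (W x)) = \<phi> x" for x
    using \<Phi>_walk W by (auto simp: \<phi>_def)
  have adj1: "adj (\<phi> x) (\<phi> y)" if "W y = y # W x" for x y
  proof -
    have ne: "W x \<noteq> []" using W(1)[of x] by (auto simp: walks_def)
    have "\<Phi> (W y) = \<phi> y # \<Phi> (W x)"
      using \<Phi>_W(2)[of y] ne by (simp add: that \<Phi>_simps)
    then have "\<phi> y \<in> children (\<Phi> (W x))"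
      using \<Phi>_W(1)[of y] \<Phi>_len[of "W x"] ne by (metis length_0_conv walks_Cons_children)
    then show ?thesis using \<Phi>_W(2) by (simp add: children_def)
  qed
  have adj2: "adj x y" if "\<Phi> (W y) = \<phi> y # \<Phi> (W x)" for x y
  proof -
    have ne: "W x \<noteq> []" "W y \<noteq> []" using W(1) by (auto simp: walks_def)
    then obtain t where t: "W y = y # t" using W(2)[of y] by (cases "W y") auto
    have "\<Phi> (W x) \<noteq> []" using \<Phi>_len[of "W x"] ne by auto
    then have "t \<noteq> []" using that by (auto simp: t \<Phi>_simps)
    then have "\<Phi> t = \<Phi> (W x)" "t \<in> walks u" "y \<in> children t"
      using that W(1)[of y] by (auto simp: t \<Phi>_simps walks_Cons_children)
    then have "t = W x" using \<Phi>_inj W by blast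
    then show ?thesis using \<open>y \<in> children t\<close> W(2) by (simp add: children_def)
  qed
  \<comment> \<open>By \<open>walks_adj\<close>, two vertices are adjacent only if one of their
    walks extends the other by one step; \<open>adj1\<close> and \<open>adj2\<close> carry this
    relation across \<open>\<Phi>\<close>.\<close>
  have "adj (\<phi> x) (\<phi> y) \<longleftrightarrow> adj x y" for x y
  proof
    assume "adj x y"
    then have "adj (hd (W x)) (hd (W y))" by (simp add: W)
    from walks_adj[OF W(1) W(1) this] have "W y = y # W x \<or> W x = x # W y" by (simp add: W)
    then show "adj (\<phi> x) (\<phi> y)" using adj1 adj_sym by blast
  next
    assume "adj (\<phi> x) (\<phi> y)"
    then have "adj (hd (\<Phi> (W x))) (hd (\<Phi> (W y)))" by (simp add: \<Phi>_W)
    from walks_adj[OF \<Phi>_W(1) \<Phi>_W(1) this]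
    have "\<Phi> (W y) = \<phi> y # \<Phi> (W x) \<or> \<Phi> (W x) = \<phi> x # \<Phi> (W y)" by (simp add: \<Phi>_W)
    then show "adj x y" using adj2 adj_sym by blast
  qed
  then have auto: "graph_automorphism adj \<phi>"
    using inj surj by (auto simp: graph_automorphism_def bij_def inj_def surj_def) metis
  have "\<phi> u = u'" using W_eq[of "[u]"] by (simp add: \<phi>_def \<Phi>_simps)
  moreover have "\<phi> v = v'"
    using \<Phi>_suffix[of xs0 zs0] len0 W_eq[OF xs0(1)] xs0 zs0 by (simp add: \<phi>_def)
  ultimately show ?thesis using auto that by blast
qed

lemma gdist_automorphism:
  assumes "graph_automorphism adj \<phi>"
  shows "gdist (\<phi> u) (\<phi> v) = gdist u v"
proof -
  have "(adj ^^ n) (\<phi> u) y \<longleftrightarrow> (\<exists>v. y = \<phi> v \<and> (adj ^^ n) u v)" for n y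
  proof (induction n arbitrary: y)
    case (Suc n)
    show ?case
    proof
      assume "(adj ^^ Suc n) (\<phi> u) y"
      then obtain x where "(adj ^^ n) u x" "adj (\<phi> x) y" using Suc.IH by auto
      moreover obtain v where "y = \<phi> v"
        using assms unfolding graph_automorphism_def bij_def surj_def by blast
      ultimately show "\<exists>v. y = \<phi> v \<and> (adj ^^ Suc n) u v"
        using assms by (auto simp: graph_automorphism_def)
    next
      assume "\<exists>v. y = \<phi> v \<and> (adj ^^ Suc n) u v"
      then show "(adj ^^ Suc n) (\<phi> u) y"
        using assms Suc.IH by (auto simp: graph_automorphism_def)
    qed
  qed auto
  moreover have "inj \<phi>" using assms by (auto simp: graph_automorphism_def bij_def)
  ultimately have "(adj ^^ n) (\<phi> u) (\<phi> v) \<longleftrightarrow> (adj ^^ n) u v" for n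
    by (auto dest: injD)
  then show ?thesis by (simp add: graph_dist_def)
qed

section \<open>Covariances\<close>

lemma card_gsphere: "real (card (gsphere u k)) = (if k = 0 then 1 else real d * (real d - 1) ^ (k - 1))"
proof (induction k)
  case 0
  then show ?case using card_gsphere_0 by simp
next
  case (Suc k)
  then show ?case unfolding card_gsphere_Suc by (cases k) auto
qed

abbreviation gball :: "'v \<Rightarrow> nat \<Rightarrow> 'v set" where
  "gball u m \<equiv> {w. gdist u w \<le> m}"

lemma gball_UN: "gball u m = (\<Union>k\<le>m. gsphere u k)"
  by auto

lemma finite_gball [simp]: "finite (gball u m)"
  unfolding gball_UN by auto

lemma sum_gball:
  fixes g :: "'v \<Rightarrow> real"
  shows "(\<Sum>w\<in>gball u m. g w) = (\<Sum>k\<le>m. \<Sum>w\<in>gsphere u k. g w)"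
  unfolding gball_UN by (rule sum.UNION_disjoint) auto

lemma sum_gball_radial:
  fixes f :: "nat \<Rightarrow> real"
  shows "(\<Sum>w\<in>gball u m. f (gdist u w)) = (\<Sum>k\<le>m. real (card (gsphere u k)) * f k)"
  by (simp add: sum_gball)

text \<open>Two-point homogeneity makes \<open>K n v\<close> a function of the distance from
  \<open>v\<close>, and \<open>sum_nbrs\<close> turns the approximate wave equation into the
  approximate recurrence of \<open>spherical_limit\<close>.\<close>

lemma invariant_kernel_limit:
  fixes K :: "nat \<Rightarrow> 'v \<Rightarrow> 'v \<Rightarrow> real"
  assumes d: "d \<ge> 2"
    and inv: "\<And>n \<phi> u v. graph_automorphism adj \<phi> \<Longrightarrow> K n (\<phi> u) (\<phi> v) = K n u v"
    and one: "\<And>n u. K n u u = 1"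
    and wave: "\<And>u v. (\<lambda>n. (\<Sum>x | adj u x. K n v x) - \<theta> * K n v u) \<longlonglongrightarrow> 0"
  shows "(\<lambda>n. K n v u) \<longlonglongrightarrow> spherical d \<theta> (gdist v u)"
proof -
  have "\<exists>x. gdist v x = k" for k
  proof -
    have "real (card (gsphere v k)) > 0" unfolding card_gsphere using d by auto
    then show ?thesis by (metis (mono_tags, lifting) card.empty empty_Collect_eq less_irrefl of_nat_0)
  qed
  then obtain x where x: "\<And>k. gdist v (x k) = k" by metis
  define \<kappa> where "\<kappa> n k = K n v (x k)" for n k
  have K: "K n v y = \<kappa> n (gdist v y)" for n y
  proof -
    obtain \<phi> where "graph_automorphism adj \<phi>" "\<phi> v = v" "\<phi> y = x (gdist v y)"
      using two_point_homogeneous[of v y v "x (gdist v y)"] x by metis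
    then show ?thesis using inv unfolding \<kappa>_def by metis
  qed
  have "(\<lambda>n. \<kappa> n k) \<longlonglongrightarrow> spherical d \<theta> k" for k
  proof (rule spherical_limit[OF d])
    show "\<kappa> n 0 = 1" for n using K[of n v] one by simp
    show "(\<lambda>n. real d * \<kappa> n 1 - \<theta> * \<kappa> n 0) \<longlonglongrightarrow> 0"
      using wave[of v v] unfolding K sum_nbrs by simp
    show "(\<lambda>n. \<kappa> n k + (real d - 1) * \<kappa> n (Suc (Suc k)) - \<theta> * \<kappa> n (Suc k)) \<longlonglongrightarrow> 0" for k
    proof -
      have "x (Suc k) \<noteq> v" using x[of "Suc k"] by auto
      then show ?thesis using wave[where u = "x (Suc k)" and v = v] unfolding K sum_nbrs by (simp add: x)
    qed
  qed
  then show ?thesis unfolding K .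
qed

text \<open>The truncated radial eigenfunction \<open>\<alpha>\<close> is an approximate eigenvector: the adjacency
  operator minus \<open>\<theta>\<close> maps it to a function supported on the spheres of radius \<open>m\<close> and
  \<open>m + 1\<close>.\<close>

lemma truncated_spherical_correlation:
  fixes c \<theta> :: real and \<alpha> :: "nat \<Rightarrow> real" and R :: "'v \<Rightarrow> 'v \<Rightarrow> real"
  assumes d: "d \<ge> 2" and m: "m \<ge> 1" and c: "c\<^sup>2 * (\<Sum>k\<le>m. spherical_mass d \<theta> k) = 1"
    and \<alpha>: "\<And>k. \<alpha> k = (if k \<le> m then c * spherical d \<theta> k else 0)"
    and R: "\<And>u v. R u v = (\<Sum>w\<in>gball u m. \<alpha> (gdist u w) * \<alpha> (gdist v w))"
  shows "R u u = 1"
    and "\<bar>(\<Sum>x | adj u x. R v x) - \<theta> * R v u\<bar>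
      \<le> sqrt ((real d - 1) * c\<^sup>2 * (spherical_mass d \<theta> m + spherical_mass d \<theta> (Suc m)))"
proof -
  have rec: "(real d - 1) * spherical d \<theta> (Suc (Suc k)) = \<theta> * spherical d \<theta> (Suc k) - spherical d \<theta> k" for k
    using d by simp
  have norm: "(\<Sum>w\<in>gball u m. (\<alpha> (gdist u w))\<^sup>2) = 1" for u
  proof -
    have "(\<Sum>w\<in>gball u m. (\<alpha> (gdist u w))\<^sup>2) = (\<Sum>k\<le>m. real (card (gsphere u k)) * (\<alpha> k)\<^sup>2)"
      by (rule sum_gball_radial)
    also have "\<dots> = (\<Sum>k\<le>m. c\<^sup>2 * spherical_mass d \<theta> k)"
      by (intro sum.cong) (auto simp: card_gsphere spherical_mass_def \<alpha> power_mult_distrib)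
    finally show ?thesis using c by (simp add: sum_distrib_left)
  qed
  then show "R u u = 1" by (simp add: R power2_eq_square)
  \<comment> \<open>\<open>e\<close> is the radial profile of the adjacency operator minus
    \<open>\<theta>\<close> applied to \<open>\<alpha>\<close>, with the root treated separately as
    in \<open>sum_nbrs\<close>.\<close>
  define e where "e k = (if k = 0 then real d * \<alpha> 1 else \<alpha> (k - 1) + (real d - 1) * \<alpha> (Suc k)) - \<theta> * \<alpha> k" for k
  have e_small: "e k = 0" if "k < m" for k
  proof (cases k)
    case 0
    then show ?thesis using m d_pos by (simp add: e_def \<alpha>)
  next
    case (Suc j)
    have "e k = c * spherical d \<theta> j + c * ((real d - 1) * spherical d \<theta> (Suc (Suc j))) - \<theta> * (c * spherical d \<theta> (Suc j))"
      using that Suc by (simp add: e_def \<alpha> mult.left_commute del: spherical.simps)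
    then show ?thesis unfolding rec by (simp add: algebra_simps del: spherical.simps)
  qed
  \<comment> \<open>At radius \<open>m\<close> the contribution of the \<open>d - 1\<close> outer
    neighbours has been cut off; at \<open>m + 1\<close> only that of the parent is left.\<close>
  have e_m: "e m = - c * ((real d - 1) * spherical d \<theta> (Suc m))"
  proof -
    obtain j where j: "m = Suc j" using m by (cases m) auto
    have "e m = c * spherical d \<theta> j - \<theta> * (c * spherical d \<theta> (Suc j))"
      by (simp add: e_def \<alpha> j del: spherical.simps)
    then show ?thesis unfolding j rec by (simp add: algebra_simps del: spherical.simps)
  qed
  have e_Sm: "e (Suc m) = c * spherical d \<theta> m" by (simp add: e_def \<alpha>)
  have e_large: "e k = 0" if "k > Suc m" for k using that by (auto simp: e_def \<alpha>)
  have e_norm: "(\<Sum>w\<in>gball u (Suc m). (e (gdist u w))\<^sup>2)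
      = (real d - 1) * c\<^sup>2 * (spherical_mass d \<theta> m + spherical_mass d \<theta> (Suc m))"
  proof -
    have "(\<Sum>w\<in>gball u (Suc m). (e (gdist u w))\<^sup>2) = (\<Sum>k\<le>Suc m. real (card (gsphere u k)) * (e k)\<^sup>2)"
      by (rule sum_gball_radial)
    also have "\<dots> = (\<Sum>k\<in>{m, Suc m}. real (card (gsphere u k)) * (e k)\<^sup>2)"
      using e_small by (intro sum.mono_neutral_right) auto
    also have "\<dots> = real (card (gsphere u m)) * (e m)\<^sup>2 + real (card (gsphere u (Suc m))) * (e (Suc m))\<^sup>2"
      by simp
    \<comment> \<open>The sphere of radius \<open>m + 1\<close> is \<open>d - 1\<close> times as
      large as that of radius \<open>m\<close>, so the two masses change places: \<open>e m\<close>
      yields the mass at \<open>m + 1\<close>, and \<open>e (Suc m)\<close> the mass at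
      \<open>m\<close>, each times \<open>(d - 1) * c\<^sup>2\<close>.\<close>
    also have "\<dots> = (real d - 1) * c\<^sup>2 * (spherical_mass d \<theta> m + spherical_mass d \<theta> (Suc m))"
    proof -
      obtain j where j: "m = Suc j" using m by (cases m) auto
      show ?thesis unfolding e_m e_Sm card_gsphere
        by (simp add: j spherical_mass_def power_mult_distrib del: spherical.simps)
          (simp add: power2_eq_square algebra_simps del: spherical.simps)
    qed
    finally show ?thesis .
  qed
  \<comment> \<open>By symmetry of the distance, the sum over neighbours of \<open>u\<close> acts on
    the radial function centred at \<open>w\<close>, where \<open>e\<close> describes the
    result.\<close>
  have "(\<Sum>x | adj u x. R v x) = (\<Sum>w\<in>gball v m. \<alpha> (gdist v w) * (\<Sum>x | adj u x. \<alpha> (gdist w x)))"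
    unfolding R by (subst sum.swap) (simp add: sum_distrib_left gdist_commute)
  also have "\<dots> = (\<Sum>w\<in>gball v m. \<alpha> (gdist v w) * (e (gdist u w) + \<theta> * \<alpha> (gdist u w)))"
    by (intro sum.cong) (auto simp: sum_nbrs e_def gdist_commute[of _ u] gdist_eq_0_iff)
  finally have "(\<Sum>x | adj u x. R v x) - \<theta> * R v u = (\<Sum>w\<in>gball v m. \<alpha> (gdist v w) * e (gdist u w))"
    by (simp add: R algebra_simps sum.distrib sum_distrib_left)
  then have "((\<Sum>x | adj u x. R v x) - \<theta> * R v u)\<^sup>2
      \<le> (\<Sum>w\<in>gball v m. (\<alpha> (gdist v w))\<^sup>2) * (\<Sum>w\<in>gball v m. (e (gdist u w))\<^sup>2)"
    using Cauchy_Schwarz_ineq_sum[of "\<lambda>w. \<alpha> (gdist v w)" "\<lambda>w. e (gdist u w)" "gball v m"] by simp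
  also have "\<dots> = (\<Sum>w\<in>gball v m. (e (gdist u w))\<^sup>2)" by (simp add: norm)
  \<comment> \<open>Passing to the ball around \<open>u\<close>, outside which
    \<open>e (gdist u w)\<close> vanishes, makes the bound independent of \<open>v\<close>.\<close>
  also have "\<dots> \<le> (\<Sum>w\<in>gball v m \<union> gball u (Suc m). (e (gdist u w))\<^sup>2)"
    by (intro sum_mono2) auto
  also have "\<dots> = (\<Sum>w\<in>gball u (Suc m). (e (gdist u w))\<^sup>2)"
    using e_large by (intro sum.mono_neutral_right) auto
  finally show "\<bar>(\<Sum>x | adj u x. R v x) - \<theta> * R v u\<bar>
      \<le> sqrt ((real d - 1) * c\<^sup>2 * (spherical_mass d \<theta> m + spherical_mass d \<theta> (Suc m)))"
    unfolding e_norm using real_sqrt_le_mono by fastforce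
qed

lemma radial_correlation_automorphism:
  assumes "graph_automorphism adj \<phi>"
  shows "(\<Sum>w\<in>gball (\<phi> u) m. \<alpha> (gdist (\<phi> u) w) * \<alpha> (gdist (\<phi> v) w))
    = (\<Sum>w\<in>gball u m. \<alpha> (gdist u w) * \<alpha> (gdist v w) :: real)"
proof (rule sum.reindex_bij_betw[symmetric, of \<phi> "gball u m" "gball (\<phi> u) m" "\<lambda>w. \<alpha> (gdist (\<phi> u) w) * \<alpha> (gdist (\<phi> v) w)",
      unfolded gdist_automorphism[OF assms]])
  have "bij \<phi>" using assms by (simp add: graph_automorphism_def)
  then have "\<phi> ` gball u m = gball (\<phi> u) m"
    by (auto simp: gdist_automorphism[OF assms] image_iff) (metis bij_pointE gdist_automorphism[OF assms])
  then show "bij_betw \<phi> (gball u m) (gball (\<phi> u) m)"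
    using \<open>bij \<phi>\<close> by (auto simp: bij_betw_def bij_def intro: inj_on_subset)
qed

text \<open>Multiplying the wave equation at \<open>u\<close> by \<open>X v\<close> and integrating
  gives it for the covariance without error, so the limit lemma applies to a constant
  sequence.\<close>

lemma gaussian_wave_function_covariance:
  assumes d: "d \<ge> 2" and X: "gaussian_wave_function adj \<theta> N X"
  shows "(\<integral>\<omega>. X v \<omega> * X u \<omega> \<partial>N) = spherical d \<theta> (gdist v u)"
proof -
  have G: "gaussian_process N X" and I: "invariant_process adj N X"
    and V: "\<And>v. prob_space.variance N (X v) = 1"
    and wave: "AE \<omega> in N. \<forall>v. (\<Sum>u | adj v u. X u \<omega>) = \<theta> * X v \<omega>"
    using X by (auto simp: gaussian_wave_function_def)
  interpret prob_space N using G by (simp add: gaussian_process_def)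
  note cn = centered_normal_moments[OF gaussian_process_centered_normal[OF G]]
  note int = gaussian_process_integrable_mult[OF G]
  have [measurable]: "X v \<in> borel_measurable N" for v
    using gaussian_process_centered_normal[OF G] by (simp add: centered_normal_def)
  have "(\<lambda>n::nat. \<integral>\<omega>. X v \<omega> * X u \<omega> \<partial>N) \<longlonglongrightarrow> spherical d \<theta> (gdist v u)"
  proof (rule invariant_kernel_limit[OF d])
    fix \<phi> u v assume \<phi>: "graph_automorphism adj \<phi>"
    let ?P = "\<Pi>\<^sub>M v\<in>(UNIV::'v set). (borel :: real measure)"
    have m: "(\<lambda>\<omega> v. X (\<psi> v) \<omega>) \<in> measurable N ?P" for \<psi>
      by (rule measurable_PiM_single') auto
    have "(\<integral>\<omega>. X (\<psi> u) \<omega> * X (\<psi> v) \<omega> \<partial>N) = (\<integral>x. x u * x v \<partial>distr N ?P (\<lambda>\<omega> v. X (\<psi> v) \<omega>))" for \<psi>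
      by (subst integral_distr[OF m]) auto
    from this[of \<phi>] this[of id] show "(\<integral>\<omega>. X (\<phi> u) \<omega> * X (\<phi> v) \<omega> \<partial>N) = (\<integral>\<omega>. X u \<omega> * X v \<omega> \<partial>N)"
      using I \<phi> by (simp add: invariant_process_def)
  next
    show "(\<integral>\<omega>. X u \<omega> * X u \<omega> \<partial>N) = 1" for u
      using V[of u] cn(3)[of u] by (simp add: power2_eq_square)
  next
    fix u v
    have "(\<Sum>x | adj u x. \<integral>\<omega>. X v \<omega> * X x \<omega> \<partial>N) = (\<integral>\<omega>. X v \<omega> * (\<Sum>x | adj u x. X x \<omega>) \<partial>N)"
      by (simp add: sum_distrib_left int)
    also have "\<dots> = (\<integral>\<omega>. \<theta> * (X v \<omega> * X u \<omega>) \<partial>N)"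
      by (rule integral_cong_AE) (use wave in auto)
    finally show "(\<lambda>n::nat. (\<Sum>x | adj u x. \<integral>\<omega>. X v \<omega> * X x \<omega> \<partial>N) - \<theta> * (\<integral>\<omega>. X v \<omega> * X u \<omega> \<partial>N)) \<longlonglongrightarrow> 0"
      by simp
  qed
  then show ?thesis by (simp add: LIMSEQ_const_iff)
qed

end

theorem theorem4:
  fixes d :: nat and \<theta> :: real
    and adj :: "'v \<Rightarrow> 'v \<Rightarrow> bool"
    and M :: "'a measure" and Z :: "'v \<Rightarrow> 'a \<Rightarrow> real"
    and N :: "'b measure" and X :: "'v \<Rightarrow> 'b \<Rightarrow> real"
  assumes "d \<ge> 3"
    and "regular_tree d adj"
    and "\<bar>\<theta>\<bar> \<le> 2 * sqrt (real d - 1)"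
    and "prob_space M" and "iid_std_normal M Z"
    and "gaussian_wave_function adj \<theta> N X"
  shows "\<exists>Y :: nat \<Rightarrow> 'v \<Rightarrow> 'a \<Rightarrow> real.
           (\<forall>n. linear_factor_of_iid d adj M Z (Y n)) \<and> fdd_converges M Y N X"
proof -
  have d: "d \<ge> 2" using assms(1) by simp
  interpret regular_tree_graph d adj
    using assms(1,2) by unfold_locales auto
  have mass_nonneg: "spherical_mass d \<theta> k \<ge> 0" for k
    using d by (simp add: spherical_mass_def)
  obtain C where C: "\<And>k. spherical_mass d \<theta> k \<le> C * (real k + 1)\<^sup>2"
    using spherical_mass_bound[OF d assms(3)] by blast
  \<comment> \<open>The tolerance \<open>1 / (n + 1)\<close> becomes an error of at most
    \<open>sqrt ((d - 1) / (n + 1))\<close> in the wave equation for the covariances.\<close>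
  have "\<exists>m\<ge>1. spherical_mass d \<theta> m + spherical_mass d \<theta> (Suc m)
      \<le> 1 / real (Suc n) * (\<Sum>j\<le>m. spherical_mass d \<theta> j)" for n
    by (rule subexponential_boundary[OF _ mass_nonneg C]) (auto simp: spherical_mass_def)
  then obtain m where m: "\<And>n. m n \<ge> 1" "\<And>n. spherical_mass d \<theta> (m n) + spherical_mass d \<theta> (Suc (m n))
      \<le> 1 / real (Suc n) * (\<Sum>j\<le>m n. spherical_mass d \<theta> j)"
    by metis
  \<comment> \<open>This normalisation gives every \<open>Y n v\<close> variance 1.\<close>
  define c where "c n = 1 / sqrt (\<Sum>j\<le>m n. spherical_mass d \<theta> j)" for n
  have c: "(c n)\<^sup>2 * (\<Sum>j\<le>m n. spherical_mass d \<theta> j) = 1" for n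
  proof -
    have "spherical_mass d \<theta> 0 \<le> (\<Sum>j\<le>m n. spherical_mass d \<theta> j)"
      using mass_nonneg by (intro member_le_sum) auto
    then have "(\<Sum>j\<le>m n. spherical_mass d \<theta> j) > 0" by (simp add: spherical_mass_def)
    then show ?thesis by (simp add: c_def power_divide)
  qed
  define \<alpha> where "\<alpha> n k = (if k \<le> m n then c n * spherical d \<theta> k else 0)" for n k
  define Y where "Y n v \<omega> = (\<Sum>w\<in>gball v (m n). \<alpha> n (gdist v w) * Z w \<omega>)" for n v \<omega>
  define R where "R n u v = (\<Sum>w\<in>gball u (m n). \<alpha> n (gdist u w) * \<alpha> n (gdist v w))" for n u v
  note corr = truncated_spherical_correlation[OF d m(1) c \<alpha>_def R_def]
  have gauss: "gaussian_process M (Y n)"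
    and cov: "(\<integral>\<omega>. Y n u \<omega> * Y n v \<omega> \<partial>M) = R n u v" for n u v
    unfolding Y_def R_def
    using linear_process[OF assms(4,5), of "\<lambda>v. gball v (m n)" "\<lambda>v w. \<alpha> n (gdist v w)"]
    by (auto simp: \<alpha>_def)
  have "(\<lambda>n. R n v u) \<longlonglongrightarrow> spherical d \<theta> (gdist v u)" for u v
  proof (rule invariant_kernel_limit[OF d])
    show "R n (\<phi> u) (\<phi> v) = R n u v" if "graph_automorphism adj \<phi>" for n \<phi> u v
      unfolding R_def by (rule radial_correlation_automorphism[OF that])
    show "R n u u = 1" for n u by (rule corr(1))
    fix u v
    show "(\<lambda>n. (\<Sum>x | adj u x. R n v x) - \<theta> * R n v u) \<longlonglongrightarrow> 0"
    proof (rule Lim_null_comparison)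
      have "\<bar>(\<Sum>x | adj u x. R n v x) - \<theta> * R n v u\<bar> \<le> sqrt ((real d - 1) * (1 / real (Suc n)))" for n
      proof -
        have "(c n)\<^sup>2 * (spherical_mass d \<theta> (m n) + spherical_mass d \<theta> (Suc (m n)))
            \<le> (c n)\<^sup>2 * (1 / real (Suc n) * (\<Sum>j\<le>m n. spherical_mass d \<theta> j))"
          by (intro mult_left_mono m(2)) simp
        also have "\<dots> = 1 / real (Suc n)" using c[of n] by (metis mult.left_commute mult.right_neutral)
        finally have "(real d - 1) * ((c n)\<^sup>2 * (spherical_mass d \<theta> (m n) + spherical_mass d \<theta> (Suc (m n))))
            \<le> (real d - 1) * (1 / real (Suc n))"
          using d by (intro mult_left_mono) auto
        from order_trans[OF corr(2)[unfolded mult.assoc] real_sqrt_le_mono[OF this]] show ?thesis .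
      qed
      then show "\<forall>\<^sub>F n in sequentially. norm ((\<Sum>x | adj u x. R n v x) - \<theta> * R n v u) \<le> sqrt ((real d - 1) * (1 / real (Suc n)))"
        by simp
      have "(\<lambda>n. sqrt ((real d - 1) * (1 / real (Suc n)))) \<longlonglongrightarrow> sqrt ((real d - 1) * 0)"
        by (intro tendsto_intros) (use LIMSEQ_inverse_real_of_nat in \<open>simp add: inverse_eq_divide\<close>)
      then show "(\<lambda>n. sqrt ((real d - 1) * (1 / real (Suc n)))) \<longlonglongrightarrow> 0" by simp
    qed
  qed
  then have "(\<lambda>n. \<integral>\<omega>. Y n u \<omega> * Y n v \<omega> \<partial>M) \<longlonglongrightarrow> (\<integral>\<omega>. X u \<omega> * X v \<omega> \<partial>N)" for u v
    unfolding cov gaussian_wave_function_covariance[OF d assms(6)] .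
  moreover have "gaussian_process N X"
    using assms(6) by (simp add: gaussian_wave_function_def)
  ultimately have "fdd_converges M Y N X"
    using gauss by (intro gaussian_fdd_converges)
  moreover have "linear_factor_of_iid d adj M Z (Y n)" for n
    unfolding linear_factor_of_iid_def
  proof (intro conjI allI exI[of _ "\<alpha> n"])
    show "Y n v \<in> borel_measurable M" for v
      using gaussian_process_centered_normal[OF gauss] by (simp add: centered_normal_def)
    show "summable (\<lambda>k. real d * (real d - 1) ^ k * (\<alpha> n (Suc k))\<^sup>2)"
      by (rule summable_finite[of "{..m n}"]) (auto simp: \<alpha>_def)
    \<comment> \<open>The coefficients vanish beyond \<open>m n\<close>, so the series is a finite
      sum and the identity holds at every \<open>\<omega>\<close>.\<close>
    show "AE \<omega> in M. (\<lambda>k. \<Sum>u | gdist v u = k. \<alpha> n k * Z u \<omega>) sums Y n v \<omega>" for v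
    proof (rule AE_I2)
      fix \<omega>
      have "Y n v \<omega> = (\<Sum>k\<le>m n. \<Sum>u | gdist v u = k. \<alpha> n k * Z u \<omega>)"
        unfolding Y_def sum_gball by (intro sum.cong) auto
      then show "(\<lambda>k. \<Sum>u | gdist v u = k. \<alpha> n k * Z u \<omega>) sums Y n v \<omega>"
        using sums_finite[of "{..m n}" "\<lambda>k. \<Sum>u | gdist v u = k. \<alpha> n k * Z u \<omega>"]
        by (auto simp: \<alpha>_def)
    qed
  qed
  ultimately show ?thesis by blast
qed

end
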